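(* Let $\Sigma$ be a surface diffeomorphic to $S^2$, let $X:\Sigma\hookrightarrow\mathbb{R}^{3,1}$ be a space-like embedding with mean curvature vector $H_0$, let $T_0$ be a constant future-directed unit time-like vector, and let $\tau=-\langle X,T_0\rangle$. Let $\widehat\Sigma$ be the image of the projection $\widehat X=X-\tau T_0$ into $\mathbb{R}^3=T_0^\perp$; assume $\widehat X$ is an embedding, and let $\hat\nu$ be the outward unit normal of $\widehat\Sigma$ in $\mathbb{R}^3$ and $\hat k$ the mean curvature of $\widehat\Sigma$ with respect to $\hat\nu$. Let $\breve e_3$ be the normal vector field along $\Sigma$ obtained by extending $\hat\nu$ along $T_0$ by parallel translation. Then $$\int_{\widehat\Sigma}\hat k\,dv_{\widehat\Sigma}=\int_\Sigma\Big[-\langle H_0,\breve e_3\rangle\sqrt{1+|\nabla\tau|^2}-\alpha_{\breve e_3}(\nabla\tau)\Big]dv_\Sigma .$$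
   Context: All objects are smooth. $\langle\cdot,\cdot\rangle$ is the Lorentzian metric (signature $(-+++)$) of Minkowski space $\mathbb{R}^{3,1}$ and $\nabla^{\mathbb{R}^{3,1}}$ its flat connection. $\nabla$, $|\cdot|$, $dv_\Sigma$ refer to the metric induced on $\Sigma$ by $X$. $H_0$ is the trace of the second fundamental form $\mathrm{II}(Y,Z)=(\nabla^{\mathbb{R}^{3,1}}_YZ)^\perp$ of $\Sigma$. The vector field $\breve e_3$ is a space-like unit normal of $\Sigma$ orthogonal to $T_0$, and $\alpha_{\breve e_3}(Y)=\langle\nabla^{\mathbb{R}^{3,1}}_Y\breve e_3,\breve e_4\rangle$, where $\breve e_4$ is the future-directed time-like unit normal of $\Sigma$ orthogonal to $\breve e_3$. The mean curvature of $\widehat\Sigma$ is $\hat k=\sum_a\langle\nabla^{\mathbb{R}^{3,1}}_{\hat e_a}\hat\nu,\hat e_a\rangle$ for an orthonormal tangent frame $\hat e_1,\hat e_2$ of $\widehat\Sigma$. *)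

theory Defs
  imports "HOL-Analysis.Analysis"
begin

section \<open>Smooth maps\<close>

primrec Ck_on :: "nat \<Rightarrow> 'a::real_normed_vector set \<Rightarrow> ('a \<Rightarrow> 'b::real_normed_vector) \<Rightarrow> bool" where
  "Ck_on 0 U f \<longleftrightarrow> continuous_on U f"
| "Ck_on (Suc k) U f \<longleftrightarrow>
     (\<forall>x\<in>U. f differentiable (at x)) \<and> (\<forall>v. Ck_on k U (\<lambda>x. frechet_derivative f (at x) v))"

text \<open>Only used for open \<^term>\<open>U\<close>; a smooth map is \<open>C\<^sup>\<infinity>\<close>.\<close>

definition smooth_on :: "'a::real_normed_vector set \<Rightarrow> ('a \<Rightarrow> 'b::real_normed_vector) \<Rightarrow> bool" where
  "smooth_on U f \<longleftrightarrow> (\<forall>k. Ck_on k U f)"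

section \<open>Abstract smooth surfaces\<close>

text \<open>
  An atlas is a set of local parametrizations \<open>(U, p)\<close>, where \<open>p\<close> maps the open set \<open>U\<close> of the
  plane homeomorphically onto an open set of the surface; \<open>p\<close> is the inverse of a chart, and its
  values outside \<open>U\<close> are irrelevant. The atlas is not required to be maximal.
\<close>

type_synonym 'a atlas = "((real^2) set \<times> (real^2 \<Rightarrow> 'a)) set"

definition smooth_surface :: "'a topology \<Rightarrow> 'a atlas \<Rightarrow> bool" where
  "smooth_surface S A \<longleftrightarrow>
     Hausdorff_space S \<and> second_countable S \<and>
     (\<forall>(U, p)\<in>A. open U \<and> openin S (p ` U) \<and>
        homeomorphic_map (top_of_set U) (subtopology S (p ` U)) p) \<and>
     (\<Union>(U, p)\<in>A. p ` U) = topspace S \<and>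
     (\<forall>(U, p)\<in>A. \<forall>(V, q)\<in>A. smooth_on {u \<in> U. p u \<in> q ` V} (inv_into V q \<circ> p))"

definition smooth_surface_map ::
    "'a topology \<Rightarrow> 'a atlas \<Rightarrow> 'b topology \<Rightarrow> 'b atlas \<Rightarrow> ('a \<Rightarrow> 'b) \<Rightarrow> bool" where
  "smooth_surface_map S A S' A' f \<longleftrightarrow>
     continuous_map S S' f \<and>
     (\<forall>(U, p)\<in>A. \<forall>(V, q)\<in>A'. smooth_on {u \<in> U. f (p u) \<in> q ` V} (inv_into V q \<circ> f \<circ> p))"

definition diffeomorphic_surfaces ::
    "'a topology \<Rightarrow> 'a atlas \<Rightarrow> 'b topology \<Rightarrow> 'b atlas \<Rightarrow> bool" where
  "diffeomorphic_surfaces S A S' A' \<longleftrightarrow>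
     (\<exists>f g. homeomorphic_maps S S' f g \<and>
        smooth_surface_map S A S' A' f \<and> smooth_surface_map S' A' S A g)"

definition stereographic :: "real \<Rightarrow> real^2 \<Rightarrow> real^3" where
  "stereographic s u =
     (1 / (1 + (norm u)\<^sup>2)) *\<^sub>R vector [2 * u$1, 2 * u$2, s * ((norm u)\<^sup>2 - 1)]"

text \<open>The values \<open>s = 1\<close> and \<open>s = -1\<close> give the inverses of the stereographic projections from the
  north and from the south pole.\<close>

definition sphere_atlas :: "(real^3) atlas" where
  "sphere_atlas = {(UNIV, stereographic 1), (UNIV, stereographic (-1))}"

definition diffeomorphic_S2 :: "'a topology \<Rightarrow> 'a atlas \<Rightarrow> bool" where
  "diffeomorphic_S2 S A \<longleftrightarrow>
     diffeomorphic_surfaces S A (top_of_set (sphere (0::real^3) 1)) sphere_atlas"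

definition image_atlas :: "('a \<Rightarrow> 'b) \<Rightarrow> 'a atlas \<Rightarrow> 'b atlas" where
  "image_atlas f A = (\<lambda>(U, p). (U, f \<circ> p)) ` A"

definition smooth_along :: "'a atlas \<Rightarrow> 'a set \<Rightarrow> ('a \<Rightarrow> 'b::real_normed_vector) \<Rightarrow> bool" where
  "smooth_along A W f \<longleftrightarrow> (\<forall>(U, p)\<in>A. smooth_on {u \<in> U. p u \<in> W} (f \<circ> p))"

definition smooth_embedding ::
    "'a topology \<Rightarrow> 'a atlas \<Rightarrow> ('a \<Rightarrow> 'b::real_normed_vector) \<Rightarrow> bool" where
  "smooth_embedding S A X \<longleftrightarrow>
     embedding_map S euclidean X \<and> smooth_along A (topspace S) X \<and>
     (\<forall>(U, p)\<in>A. \<forall>u\<in>U. inj (frechet_derivative (X \<circ> p) (at u)))"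

section \<open>Minkowski space\<close>

text \<open>The first component is time; the Lorentzian metric has signature \<open>(- + + +)\<close>.\<close>

type_synonym minkowski = "real \<times> (real^3)"

definition lorentz :: "minkowski \<Rightarrow> minkowski \<Rightarrow> real" where
  "lorentz v w = - (fst v * fst w) + snd v \<bullet> snd w"

definition future_unit_timelike :: "minkowski \<Rightarrow> bool" where
  "future_unit_timelike v \<longleftrightarrow> lorentz v v = -1 \<and> fst v > 0"

definition orth_complement :: "minkowski \<Rightarrow> minkowski set" where
  "orth_complement T = {v. lorentz v T = 0}"

section \<open>Geometry of a space-like surface in Minkowski space\<close>

text \<open>
  Throughout, \<open>X\<close> is an immersion of the surface with atlas \<open>A\<close> into Minkowski space. The tangent
  space of the surface at \<open>x\<close> is identified with its image under the differential of \<open>X\<close>.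
  All definite descriptions below determine a unique object when \<open>X\<close> is a space-like embedding, the
  functions on the surface are smooth, and the vectors \<open>Y\<close>, \<open>Z\<close> are tangent at \<open>x\<close>.
\<close>

definition tangent_space :: "'a atlas \<Rightarrow> ('a \<Rightarrow> minkowski) \<Rightarrow> 'a \<Rightarrow> minkowski set" where
  "tangent_space A X x =
     {frechet_derivative (X \<circ> p) (at u) \<xi> | U p u \<xi>. (U, p) \<in> A \<and> u \<in> U \<and> p u = x}"

definition spacelike :: "'a topology \<Rightarrow> 'a atlas \<Rightarrow> ('a \<Rightarrow> minkowski) \<Rightarrow> bool" where
  "spacelike S A X \<longleftrightarrow>
     (\<forall>x\<in>topspace S. \<forall>Y\<in>tangent_space A X x. Y \<noteq> 0 \<longrightarrow> lorentz Y Y > 0)"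

text \<open>
  Derivative at \<open>x\<close> of a function \<open>f\<close> on the surface in the direction of the tangent vector \<open>Y\<close>.
  If \<open>f\<close> takes values in Minkowski space, i.e. is a vector field along the surface, this is the
  covariant derivative of \<open>f\<close> for the flat connection.
\<close>

definition surf_deriv ::
    "'a atlas \<Rightarrow> ('a \<Rightarrow> minkowski) \<Rightarrow> ('a \<Rightarrow> 'b::real_normed_vector) \<Rightarrow> 'a \<Rightarrow> minkowski \<Rightarrow> 'b" where
  "surf_deriv A X f x Y =
     (THE w. \<exists>U p u \<xi>. (U, p) \<in> A \<and> u \<in> U \<and> p u = x \<and>
        frechet_derivative (X \<circ> p) (at u) \<xi> = Y \<and> w = frechet_derivative (f \<circ> p) (at u) \<xi>)"

definition normal_part :: "minkowski set \<Rightarrow> minkowski \<Rightarrow> minkowski" where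
  "normal_part T v = (THE n. v - n \<in> T \<and> (\<forall>Y\<in>T. lorentz n Y = 0))"

text \<open>Second fundamental form \<open>II(Y,Z) = (\<nabla>\<^sub>Y Z)\<^sup>\<bottom>\<close>, where the vector \<open>Z\<close> is extended to a
  smooth tangent field near \<open>x\<close>.\<close>

definition second_fundamental_form ::
    "'a topology \<Rightarrow> 'a atlas \<Rightarrow> ('a \<Rightarrow> minkowski) \<Rightarrow> 'a \<Rightarrow> minkowski \<Rightarrow> minkowski \<Rightarrow> minkowski" where
  "second_fundamental_form S A X x Y Z =
     (THE w. \<exists>W F. openin S W \<and> x \<in> W \<and> smooth_along A W F \<and>
        (\<forall>y\<in>W. F y \<in> tangent_space A X y) \<and> F x = Z \<and>
        w = normal_part (tangent_space A X x) (surf_deriv A X F x Y))"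

definition orthonormal_frame :: "minkowski set \<Rightarrow> minkowski \<Rightarrow> minkowski \<Rightarrow> bool" where
  "orthonormal_frame T e1 e2 \<longleftrightarrow>
     e1 \<in> T \<and> e2 \<in> T \<and> lorentz e1 e1 = 1 \<and> lorentz e2 e2 = 1 \<and> lorentz e1 e2 = 0"

definition metric_trace :: "minkowski set \<Rightarrow> (minkowski \<Rightarrow> minkowski \<Rightarrow> 'b::plus) \<Rightarrow> 'b" where
  "metric_trace T B = (THE h. \<exists>e1 e2. orthonormal_frame T e1 e2 \<and> h = B e1 e1 + B e2 e2)"

definition mean_curvature_vector ::
    "'a topology \<Rightarrow> 'a atlas \<Rightarrow> ('a \<Rightarrow> minkowski) \<Rightarrow> 'a \<Rightarrow> minkowski" where
  "mean_curvature_vector S A X x =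
     metric_trace (tangent_space A X x) (second_fundamental_form S A X x)"

definition mean_curvature_wrt ::
    "'a atlas \<Rightarrow> ('a \<Rightarrow> minkowski) \<Rightarrow> ('a \<Rightarrow> minkowski) \<Rightarrow> 'a \<Rightarrow> real" where
  "mean_curvature_wrt A X \<nu> x =
     metric_trace (tangent_space A X x) (\<lambda>Y Z. lorentz (surf_deriv A X \<nu> x Y) Z)"

definition surf_gradient :: "'a atlas \<Rightarrow> ('a \<Rightarrow> minkowski) \<Rightarrow> ('a \<Rightarrow> real) \<Rightarrow> 'a \<Rightarrow> minkowski" where
  "surf_gradient A X f x =
     (THE G. G \<in> tangent_space A X x \<and>
        (\<forall>Y\<in>tangent_space A X x. lorentz G Y = surf_deriv A X f x Y))"

definition connection_form ::
    "'a atlas \<Rightarrow> ('a \<Rightarrow> minkowski) \<Rightarrow> ('a \<Rightarrow> minkowski) \<Rightarrow> ('a \<Rightarrow> minkowski) \<Rightarrow>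
      'a \<Rightarrow> minkowski \<Rightarrow> real" where
  "connection_form A X e3 e4 x Y = lorentz (surf_deriv A X e3 x Y) (e4 x)"

definition unit_normal_e4 ::
    "'a topology \<Rightarrow> 'a atlas \<Rightarrow> ('a \<Rightarrow> minkowski) \<Rightarrow> ('a \<Rightarrow> minkowski) \<Rightarrow> ('a \<Rightarrow> minkowski) \<Rightarrow> bool" where
  "unit_normal_e4 S A X e3 e4 \<longleftrightarrow>
     (\<forall>x\<in>topspace S. future_unit_timelike (e4 x) \<and> lorentz (e4 x) (e3 x) = 0 \<and>
        (\<forall>Y\<in>tangent_space A X x. lorentz (e4 x) Y = 0))"

text \<open>The density \<open>\<surd>(det g)\<close> of the induced metric in the parametrization \<open>p\<close>.\<close>

definition area_density :: "('a \<Rightarrow> minkowski) \<Rightarrow> (real^2 \<Rightarrow> 'a) \<Rightarrow> real^2 \<Rightarrow> real" where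
  "area_density X p u =
     (let d1 = frechet_derivative (X \<circ> p) (at u) (axis 1 1);
          d2 = frechet_derivative (X \<circ> p) (at u) (axis 2 1)
      in sqrt (lorentz d1 d1 * lorentz d2 d2 - (lorentz d1 d2)\<^sup>2))"

definition area_measure :: "'a topology \<Rightarrow> 'a atlas \<Rightarrow> ('a \<Rightarrow> minkowski) \<Rightarrow> 'a measure" where
  "area_measure S A X =
     (THE \<mu>. space \<mu> = topspace S \<and> sets \<mu> = sigma_sets (topspace S) {W. openin S W} \<and>
        (\<forall>(U, p)\<in>A. \<forall>B\<in>sets \<mu>. B \<subseteq> p ` U \<longrightarrow>
           emeasure \<mu> B =
             (\<integral>\<^sup>+u. ennreal (area_density X p u) * indicator {u \<in> U. p u \<in> B} u \<partial>lborel)))"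

section \<open>Surfaces in a space-like hyperplane\<close>

text \<open>The unbounded component of the complement of \<open>K\<close> in the hyperplane \<open>P\<close>. (The library's
  \<^const>\<open>outside\<close> refers to the complement in the whole space.)\<close>

definition outside_in :: "minkowski set \<Rightarrow> minkowski set \<Rightarrow> minkowski set" where
  "outside_in P K = {y \<in> P - K. \<not> bounded (connected_component_set (P - K) y)}"

text \<open>\<open>K\<close> is a surface in the hyperplane \<open>P\<close> and \<open>A\<close> an atlas of \<open>K\<close>, so its immersion is the
  identity.\<close>

definition outward_unit_normal ::
    "minkowski set \<Rightarrow> minkowski set \<Rightarrow> minkowski atlas \<Rightarrow> (minkowski \<Rightarrow> minkowski) \<Rightarrow> bool" where
  "outward_unit_normal P K A \<nu> \<longleftrightarrow>
     smooth_along A K \<nu> \<and>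
     (\<forall>y\<in>K. \<nu> y \<in> P \<and> lorentz (\<nu> y) (\<nu> y) = 1 \<and>
        (\<forall>Y\<in>tangent_space A id y. lorentz (\<nu> y) Y = 0) \<and>
        (\<exists>\<epsilon>>0. \<forall>t. 0 < t \<and> t < \<epsilon> \<longrightarrow> y + t *\<^sub>R \<nu> y \<in> outside_in P K))"

end

theory Submission
  imports Defs
begin

text \<open>
  The identity holds pointwise, without integration by parts. In a chart with tangent vectors
  \<open>d\<^sub>i\<close>, write \<open>t\<^sub>i\<close> for the derivatives of \<open>\<tau>\<close>, \<open>G = \<nabla>\<tau>\<close>, \<open>R = \<surd>(1 + |G|\<^sup>2)\<close> and
  \<open>h\<^sub>i\<^sub>j = \<langle>\<partial>\<^sub>i e\<^sub>3, d\<^sub>j\<rangle>\<close>. The projection has the metric \<open>g\<^sub>i\<^sub>j + t\<^sub>i t\<^sub>j\<close>, hence the area element is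
  multiplied by \<open>R\<close>, and since \<open>e\<^sub>3\<close> is orthogonal to \<open>T\<^sub>0\<close>, its second fundamental form is again
  \<open>h\<^sub>i\<^sub>j\<close>. Inverting the rank-one perturbation of \<open>g\<close>, its mean curvature is
  \<open>tr\<^sub>g h - h(G,G) / R\<^sup>2\<close>. On the other side \<open>\<langle>H\<^sub>0, e\<^sub>3\<rangle> = - tr\<^sub>g h\<close>, and the
  tangential part of \<open>T\<^sub>0\<close> is \<open>- G\<close>, so that \<open>e\<^sub>4 = (T\<^sub>0 + G) / R\<close> and \<open>\<alpha>(G) = h(G,G) / R\<close>.
\<close>

section \<open>Smooth maps\<close>

text \<open>The pointwise computation is short; most of the work gives it objects to compute with.
  \<open>surf_deriv\<close>, \<open>normal_part\<close>, \<open>second_fundamental_form\<close>,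
  \<open>metric_trace\<close>, \<open>surf_gradient\<close> and \<open>area_measure\<close> are
  definite descriptions, so each needs existence and uniqueness before anything is known about its
  value. For the geometric ones this yields explicit formulas in the coordinate vectors of one
  chart, with Cramer's rule in the tangent plane supplying the coefficients. The area measure is
  prescribed only on sets inside a single chart; it is obtained by gluing, and on the projected
  surface by pushing forward along \<open>Xhat\<close>. The curvatures in the integrands are known
  only chart by chart. The two changes of measure are therefore proved for arbitrary integrands: the
  Bochner integral of a non-integrable function is 0, and the invertibility of \<open>Xhat\<close>
  together with the positivity of \<open>\<surd>(1 + |\<nabla>\<tau>|\<^sup>2)\<close> makes
  measurability on one side equivalent to measurability on the other.\<close>

lemma Ck_on_cong:
  assumes "open U" "\<And>x. x \<in> U \<Longrightarrow> f x = g x" "Ck_on k U f"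
  shows "Ck_on k U g"
  using assms(2,3)
proof (induction k arbitrary: f g)
  case 0
  then show ?case using continuous_on_cong[of U U f g] by simp
next
  case (Suc k)
  have eq: "(f has_derivative f') (at x) \<Longrightarrow> (g has_derivative f') (at x)" if "x \<in> U" for x f'
    using has_derivative_transform_within_open[OF _ \<open>open U\<close> that] Suc.prems(1) by blast
  have d: "f differentiable (at x)" if "x \<in> U" for x
    using Suc.prems(2) that by simp
  have "frechet_derivative f (at x) v = frechet_derivative g (at x) v" if "x \<in> U" for x v
    using frechet_derivative_transform_within_open[OF d[OF that] \<open>open U\<close> that] Suc.prems(1) by simp
  then have "Ck_on k U (\<lambda>x. frechet_derivative g (at x) v)" for v
    using Suc.IH[of "\<lambda>x. frechet_derivative f (at x) v"] Suc.prems(2) by simp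
  then show ?case
    using differentiable_def d eq by (metis Ck_on.simps(2))
qed

lemma Ck_on_SucD: "Ck_on (Suc k) U f \<Longrightarrow> Ck_on k U f"
proof (induction k arbitrary: f)
  case 0
  then show ?case
    by (auto intro!: continuous_at_imp_continuous_on differentiable_imp_continuous_within)
next
  case (Suc k)
  from Suc.prems have "f differentiable (at x)" if "x \<in> U" for x
    using that by simp
  moreover from Suc.prems have "Ck_on (Suc k) U (\<lambda>x. frechet_derivative f (at x) v)" for v
    unfolding Ck_on.simps(2)[of "Suc k"] by blast
  ultimately show ?case
    using Suc.IH by simp
qed

lemma Ck_on_const: "Ck_on k U (\<lambda>x. c)"
  by (induction k arbitrary: c) auto

text \<open>The pattern of all closure rules below: the derivative of the combined map is known as a
  formula at the points of \<open>U\<close>, the induction hypothesis makes the formula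
  \<open>k\<close> times differentiable, and \<open>Ck_on_cong\<close> carries this over to
  \<open>frechet_derivative\<close> itself.\<close>

lemma Ck_on_add:
  assumes "open U" "Ck_on k U f" "Ck_on k U g"
  shows "Ck_on k U (\<lambda>x. f x + g x)"
  using assms(2,3)
proof (induction k arbitrary: f g)
  case 0
  then show ?case by (auto intro: continuous_intros)
next
  case (Suc k)
  have "frechet_derivative (\<lambda>x. f x + g x) (at x) v =
      frechet_derivative f (at x) v + frechet_derivative g (at x) v" if "x \<in> U" for x v
  proof -
    have "((\<lambda>x. f x + g x) has_derivative
        (\<lambda>v. frechet_derivative f (at x) v + frechet_derivative g (at x) v)) (at x)"
      using Suc.prems that by (auto intro!: has_derivative_add simp: frechet_derivative_works[symmetric])
    from frechet_derivative_at[OF this] show ?thesis by metis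
  qed
  then have "Ck_on k U (\<lambda>x. frechet_derivative (\<lambda>x. f x + g x) (at x) v)" for v
    using Ck_on_cong[OF \<open>open U\<close> _ Suc.IH] Suc.prems by force
  then show ?case using Suc.prems by auto
qed

lemma Ck_on_scaleR:
  fixes a :: "'a::real_normed_vector \<Rightarrow> real"
  assumes "open U" "Ck_on k U a" "Ck_on k U f"
  shows "Ck_on k U (\<lambda>x. a x *\<^sub>R f x)"
  using assms(2,3)
proof (induction k arbitrary: a f)
  case 0
  then show ?case by (auto intro: continuous_intros)
next
  case (Suc k)
  have "frechet_derivative (\<lambda>x. a x *\<^sub>R f x) (at x) v =
      a x *\<^sub>R frechet_derivative f (at x) v + frechet_derivative a (at x) v *\<^sub>R f x"
    if "x \<in> U" for x v
  proof -
    have "((\<lambda>x. a x *\<^sub>R f x) has_derivative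
        (\<lambda>v. a x *\<^sub>R frechet_derivative f (at x) v + frechet_derivative a (at x) v *\<^sub>R f x)) (at x)"
      using Suc.prems that
      by (auto intro!: has_derivative_scaleR simp: frechet_derivative_works[symmetric])
    from frechet_derivative_at[OF this] show ?thesis by metis
  qed
  \<comment> \<open>Each summand of the product rule keeps one undifferentiated factor, of order
    \<open>Suc k\<close>; \<open>Ck_on_SucD\<close> lowers it to the order \<open>k\<close> of the
    induction hypothesis.\<close>
  moreover have "Ck_on k U (\<lambda>x. a x *\<^sub>R frechet_derivative f (at x) v +
      frechet_derivative a (at x) v *\<^sub>R f x)" for v
    using Suc.prems Suc.IH Ck_on_SucD[OF Suc.prems(1)] Ck_on_SucD[OF Suc.prems(2)]
    by (intro Ck_on_add \<open>open U\<close>) auto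
  ultimately have "Ck_on k U (\<lambda>x. frechet_derivative (\<lambda>x. a x *\<^sub>R f x) (at x) v)" for v
    by (rule Ck_on_cong[OF \<open>open U\<close> sym])
  then show ?case using Suc.prems by auto
qed

lemma Ck_on_sum:
  assumes "open U" "finite I" "\<And>i. i \<in> I \<Longrightarrow> Ck_on k U (f i)"
  shows "Ck_on k U (\<lambda>x. \<Sum>i\<in>I. f i x)"
  using assms(2,3) by (induction I) (auto intro: Ck_on_const Ck_on_add[OF \<open>open U\<close>])

lemma Ck_on_bounded_linear:
  assumes "open U" "bounded_linear L" "Ck_on k U f"
  shows "Ck_on k U (\<lambda>x. L (f x))"
  using assms(3)
proof (induction k arbitrary: f)
  case 0
  then show ?case
    by (auto intro: bounded_linear.continuous_on[OF assms(2)])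
next
  case (Suc k)
  have D: "((\<lambda>x. L (f x)) has_derivative (\<lambda>v. L (frechet_derivative f (at x) v))) (at x)"
    if "x \<in> U" for x
    using Suc.prems that
    by (auto intro!: bounded_linear.has_derivative[OF assms(2)] simp: frechet_derivative_works[symmetric])
  then have "frechet_derivative (\<lambda>x. L (f x)) (at x) v = L (frechet_derivative f (at x) v)"
    if "x \<in> U" for x v
    using frechet_derivative_at that by metis
  then have "Ck_on k U (\<lambda>x. frechet_derivative (\<lambda>x. L (f x)) (at x) v)" for v
    using Ck_on_cong[OF \<open>open U\<close> _ Suc.IH] Suc.prems by force
  then show ?case using D by (auto simp: differentiable_def)
qed

text \<open>The chain rule produces the derivative of \<open>f\<close> in a direction that varies
  with \<open>x\<close>, whereas \<open>Ck_on\<close> controls derivatives in fixed directions.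
  Expanding the direction in the basis of the middle space, which is Euclidean for this purpose,
  moves the dependence on \<open>x\<close> into scalar coefficients.\<close>

lemma Ck_on_compose:
  fixes g :: "'a::real_normed_vector \<Rightarrow> 'b::euclidean_space"
  assumes "open U" "open V" "g ` U \<subseteq> V" "Ck_on k U g" "Ck_on k V f"
  shows "Ck_on k U (\<lambda>x. f (g x))"
  using assms(4,5)
proof (induction k arbitrary: f)
  case 0
  then show ?case
    using continuous_on_compose2[of V f U g] assms(3) by auto
next
  case (Suc k)
  define D where "D x v = (\<Sum>b\<in>Basis. (frechet_derivative g (at x) v \<bullet> b) *\<^sub>R
     frechet_derivative f (at (g x)) b)" for x v
  have df: "f differentiable at (g x)" and dg: "g differentiable at x" if "x \<in> U" for x
    using Suc.prems assms(3) that by auto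
  have eq: "frechet_derivative (\<lambda>x. f (g x)) (at x) v = D x v" if "x \<in> U" for x v
  proof -
    have lin: "linear (frechet_derivative f (at (g x)))"
      using df[OF that] linear_frechet_derivative by blast
    have "frechet_derivative (f \<circ> g) (at x) v =
        frechet_derivative f (at (g x)) (frechet_derivative g (at x) v)"
      using frechet_derivative_compose[OF dg df, OF that that] by simp
    also have "\<dots> = frechet_derivative f (at (g x))
        (\<Sum>b\<in>Basis. (frechet_derivative g (at x) v \<bullet> b) *\<^sub>R b)"
      by (simp add: euclidean_representation)
    also have "\<dots> = D x v"
      unfolding D_def using lin by (simp add: linear_sum linear_scale)
    finally show ?thesis by (simp add: o_def)
  qed
  have "Ck_on k U (\<lambda>x. D x v)" for v
    unfolding D_def
  proof (intro Ck_on_sum Ck_on_scaleR \<open>open U\<close> finite_Basis)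
    fix b :: 'b
    show "Ck_on k U (\<lambda>x. frechet_derivative g (at x) v \<bullet> b)"
      by (rule Ck_on_bounded_linear[OF \<open>open U\<close> bounded_linear_inner_left])
        (use Suc.prems(1) in simp)
    show "Ck_on k U (\<lambda>x. frechet_derivative f (at (g x)) b)"
      by (rule Suc.IH[OF Ck_on_SucD[OF Suc.prems(1)]]) (use Suc.prems(2) in simp)
  qed
  then have "Ck_on k U (\<lambda>x. frechet_derivative (\<lambda>x. f (g x)) (at x) v)" for v
    using Ck_on_cong[OF \<open>open U\<close>, of "\<lambda>x. D x v"] eq by simp
  moreover have "(\<lambda>x. f (g x)) differentiable at x" if "x \<in> U" for x
    using differentiable_chain_at[OF dg df, OF that that] by (simp add: o_def)
  ultimately show ?case by simp
qed

lemma smooth_on_compose: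
  fixes g :: "'a::real_normed_vector \<Rightarrow> 'b::euclidean_space"
  assumes "open U" "open V" "g ` U \<subseteq> V" "smooth_on U g" "smooth_on V f"
  shows "smooth_on U (\<lambda>x. f (g x))"
  using assms Ck_on_compose unfolding smooth_on_def by blast

lemma smooth_on_differentiable: "smooth_on U f \<Longrightarrow> x \<in> U \<Longrightarrow> f differentiable (at x)"
  unfolding smooth_on_def using Ck_on.simps(2)[of 0 U f] by blast

lemma smooth_on_frechet_derivative:
  "smooth_on U f \<Longrightarrow> smooth_on U (\<lambda>x. frechet_derivative f (at x) v)"
  unfolding smooth_on_def using Ck_on.simps(2) by blast

lemma smooth_on_continuous: "smooth_on U f \<Longrightarrow> continuous_on U f"
  unfolding smooth_on_def using Ck_on.simps(1) by blast

section \<open>Charts\<close>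

lemma surface_chart:
  assumes "smooth_surface S A" "(U, p) \<in> A"
  shows "open U" "openin S (p ` U)" "inj_on p U" "\<And>u. u \<in> U \<Longrightarrow> p u \<in> topspace S"
    "\<And>W. openin S W \<Longrightarrow> open {u \<in> U. p u \<in> W}"
    "\<And>W. open W \<Longrightarrow> W \<subseteq> U \<Longrightarrow> openin S (p ` W)"
proof -
  have *: "open U" "openin S (p ` U)" and hom: "homeomorphic_map (top_of_set U) (subtopology S (p ` U)) p"
    using assms unfolding smooth_surface_def by auto
  then show "open U" "openin S (p ` U)" by auto
  from hom show "inj_on p U" by (simp add: homeomorphic_eq_everything_map)
  show "p u \<in> topspace S" if "u \<in> U" for u
    using openin_subset[OF *(2)] that by auto
  show "open {u \<in> U. p u \<in> W}" if "openin S W" for W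
  proof -
    have "continuous_map (top_of_set U) S p"
      using homeomorphic_imp_continuous_map[OF hom] by (simp add: continuous_map_in_subtopology)
    from openin_continuous_map_preimage[OF this that] \<open>open U\<close>
    show ?thesis by (simp add: openin_open_eq)
  qed
  show "openin S (p ` W)" if "open W" "W \<subseteq> U" for W
  proof -
    have "openin (top_of_set U) W" using that by (simp add: open_openin_trans open_subset)
    then have "openin (subtopology S (p ` U)) (p ` W)"
      using homeomorphic_imp_open_map[OF hom] unfolding open_map_def by blast
    then show ?thesis using *(2) openin_trans_full by blast
  qed
qed

lemma surface_covered:
  assumes "smooth_surface S A" "x \<in> topspace S"
  obtains U p u where "(U, p) \<in> A" "u \<in> U" "p u = x"
proof -
  have "x \<in> (\<Union>(U, p)\<in>A. p ` U)"
    using assms unfolding smooth_surface_def by simp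
  then show ?thesis using that by auto
qed

lemma chart_transition:
  assumes S: "smooth_surface S A" and "(U, p) \<in> A" "(V, q) \<in> A"
  defines "\<phi> \<equiv> inv_into V q \<circ> p" and "W \<equiv> {u \<in> U. p u \<in> q ` V}"
  shows "open W" "smooth_on W \<phi>" "\<And>u. u \<in> W \<Longrightarrow> \<phi> u \<in> V" "\<And>u. u \<in> W \<Longrightarrow> q (\<phi> u) = p u"
    "inj_on \<phi> W"
proof -
  show "open W"
    unfolding W_def using surface_chart(5)[OF S assms(2) surface_chart(2)[OF S assms(3)]] .
  show "smooth_on W \<phi>"
    using S assms(2,3) unfolding smooth_surface_def W_def \<phi>_def by fast
  show "\<phi> u \<in> V" if "u \<in> W" for u
    using that by (auto simp: W_def \<phi>_def inv_into_into)
  show q: "q (\<phi> u) = p u" if "u \<in> W" for u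
    using that by (auto simp: W_def \<phi>_def f_inv_into_f)
  show "inj_on \<phi> W"
  proof (rule inj_onI)
    fix u v assume *: "u \<in> W" "v \<in> W" "\<phi> u = \<phi> v"
    then have "p u = p v" using q by metis
    then show "u = v"
      using * surface_chart(3)[OF S assms(2)] by (auto simp: W_def inj_on_def)
  qed
qed

text \<open>Near \<open>u\<close> the map \<open>f \<circ> p\<close> is \<open>f \<circ> q\<close>
  after the transition map, so this is the chain rule. It is the common source of chart independence
  for \<open>tangent_space\<close>, \<open>surf_deriv\<close> and the area.\<close>

lemma chart_derivative:
  assumes S: "smooth_surface S A" and "(U, p) \<in> A" "(V, q) \<in> A" and uv: "u \<in> U" "v \<in> V" "p u = q v"
    and d: "(f \<circ> q) differentiable at v"
  shows "(f \<circ> p) differentiable at u"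
    "frechet_derivative (f \<circ> p) (at u) \<xi> =
      frechet_derivative (f \<circ> q) (at v) (frechet_derivative (inv_into V q \<circ> p) (at u) \<xi>)"
proof -
  let ?\<phi> = "inv_into V q \<circ> p" and ?W = "{u \<in> U. p u \<in> q ` V}"
  note t = chart_transition[OF S assms(2,3)]
  have u: "u \<in> ?W" using uv by auto
  have v: "?\<phi> u = v"
    using uv surface_chart(3)[OF S assms(3)] by (simp add: inv_into_f_eq)
  have d\<phi>: "?\<phi> differentiable at u"
    using smooth_on_differentiable[OF t(2) u] .
  have dc: "((f \<circ> q) \<circ> ?\<phi>) differentiable at u"
    using differentiable_chain_at[OF d\<phi>] d v by simp
  have eq: "((f \<circ> q) \<circ> ?\<phi>) w = (f \<circ> p) w" if "w \<in> ?W" for w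
    using t(4)[OF that] by simp
  show "(f \<circ> p) differentiable at u"
    using dc has_derivative_transform_within_open[OF _ t(1) u, of "(f \<circ> q) \<circ> ?\<phi>" _ UNIV "f \<circ> p"] eq
    unfolding differentiable_def by blast
  have "frechet_derivative (f \<circ> p) (at u) = frechet_derivative ((f \<circ> q) \<circ> ?\<phi>) (at u)"
    by (rule sym, rule frechet_derivative_transform_within_open[OF dc t(1) u eq])
  also have "\<dots> = frechet_derivative (f \<circ> q) (at v) \<circ> frechet_derivative ?\<phi> (at u)"
    using frechet_derivative_compose[OF d\<phi>] d v by simp
  finally show "frechet_derivative (f \<circ> p) (at u) \<xi> =
      frechet_derivative (f \<circ> q) (at v) (frechet_derivative ?\<phi> (at u) \<xi>)"
    by simp
qed

text \<open>The set in \<open>tangent_space\<close> collects vectors from all charts;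
  \<open>chart_derivative\<close> rewrites a vector from another chart as one from \<open>p\<close>,
  with its coordinates moved by the derivative of the transition map.\<close>

lemma tangent_space_chart:
  assumes S: "smooth_surface S A" and "(U, p) \<in> A" "u \<in> U" "p u = x"
    and d: "\<And>U p u. (U, p) \<in> A \<Longrightarrow> u \<in> U \<Longrightarrow> p u = x \<Longrightarrow> (X \<circ> p) differentiable at u"
  shows "tangent_space A X x = range (frechet_derivative (X \<circ> p) (at u))"
proof
  show "tangent_space A X x \<subseteq> range (frechet_derivative (X \<circ> p) (at u))"
  proof
    fix Y assume "Y \<in> tangent_space A X x"
    then obtain V q v \<eta> where q: "(V, q) \<in> A" "v \<in> V" "q v = x"
      and Y: "Y = frechet_derivative (X \<circ> q) (at v) \<eta>"
      unfolding tangent_space_def by blast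
    have "q v = p u" using q(3) assms(4) by simp
    from chart_derivative(2)[OF S q(1) assms(2) q(2) assms(3) this d[OF assms(2-4)]]
    show "Y \<in> range (frechet_derivative (X \<circ> p) (at u))" using Y by simp
  qed
  show "range (frechet_derivative (X \<circ> p) (at u)) \<subseteq> tangent_space A X x"
    using assms(2-4) unfolding tangent_space_def by blast
qed

text \<open>Well-definedness of the description: if another chart represents the same tangent
  vector, the transition map turns its coordinates into coordinates in \<open>p\<close>, and
  injectivity of the derivative of \<open>X \<circ> p\<close> identifies these with
  \<open>\<xi>\<close>.\<close>

lemma surf_deriv_chart:
  assumes S: "smooth_surface S A" and "(U, p) \<in> A" "u \<in> U" "p u = x"
    and d: "\<And>U p u. (U, p) \<in> A \<Longrightarrow> u \<in> U \<Longrightarrow> p u = x \<Longrightarrow> (X \<circ> p) differentiable at u"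
    and inj: "inj (frechet_derivative (X \<circ> p) (at u))"
    and df: "(f \<circ> p) differentiable at u"
  shows "surf_deriv A X f x (frechet_derivative (X \<circ> p) (at u) \<xi>) =
    frechet_derivative (f \<circ> p) (at u) \<xi>"
  unfolding surf_deriv_def
proof (rule the_equality)
  show "\<exists>U' p' u' \<xi>'. (U', p') \<in> A \<and> u' \<in> U' \<and> p' u' = x \<and>
      frechet_derivative (X \<circ> p') (at u') \<xi>' = frechet_derivative (X \<circ> p) (at u) \<xi> \<and>
      frechet_derivative (f \<circ> p) (at u) \<xi> = frechet_derivative (f \<circ> p') (at u') \<xi>'"
    using assms(2-4) by blast
next
  fix w
  assume "\<exists>V q v \<eta>. (V, q) \<in> A \<and> v \<in> V \<and> q v = x \<and>
      frechet_derivative (X \<circ> q) (at v) \<eta> = frechet_derivative (X \<circ> p) (at u) \<xi> \<and>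
      w = frechet_derivative (f \<circ> q) (at v) \<eta>"
  then obtain V q v \<eta> where q: "(V, q) \<in> A" "v \<in> V" "q v = x"
    and eq: "frechet_derivative (X \<circ> q) (at v) \<eta> = frechet_derivative (X \<circ> p) (at u) \<xi>"
    and w: "w = frechet_derivative (f \<circ> q) (at v) \<eta>" by blast
  let ?\<eta> = "frechet_derivative (inv_into U p \<circ> q) (at v) \<eta>"
  have "frechet_derivative (X \<circ> p) (at u) ?\<eta> = frechet_derivative (X \<circ> p) (at u) \<xi>"
    using chart_derivative(2)[OF S q(1) assms(2) q(2) assms(3) _ d[OF assms(2-4)]] q(3) assms(4) eq
    by simp
  then have "?\<eta> = \<xi>" using inj by (simp add: inj_eq)
  then show "w = frechet_derivative (f \<circ> p) (at u) \<xi>"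
    using chart_derivative(2)[OF S q(1) assms(2) q(2) assms(3) _ df] q(3) assms(4) w by simp
qed

section \<open>The Lorentzian product\<close>

lemma lorentz_commute: "lorentz v w = lorentz w v"
  by (simp add: lorentz_def inner_commute mult.commute)

lemma lorentz_add: "lorentz (v + w) z = lorentz v z + lorentz w z" "lorentz z (v + w) = lorentz z v + lorentz z w"
  by (simp_all add: lorentz_def inner_simps algebra_simps)

lemma lorentz_diff: "lorentz (v - w) z = lorentz v z - lorentz w z" "lorentz z (v - w) = lorentz z v - lorentz z w"
  by (simp_all add: lorentz_def inner_simps algebra_simps)

lemma lorentz_scaleR: "lorentz (a *\<^sub>R v) w = a * lorentz v w" "lorentz v (a *\<^sub>R w) = a * lorentz v w"
  by (simp_all add: lorentz_def inner_simps algebra_simps)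

lemma lorentz_zero: "lorentz 0 w = 0" "lorentz v 0 = 0"
  by (simp_all add: lorentz_def)

lemmas lorentz_simps = lorentz_add lorentz_diff lorentz_scaleR lorentz_zero

lemma continuous_on_lorentz:
  "continuous_on U f \<Longrightarrow> continuous_on U g \<Longrightarrow> continuous_on U (\<lambda>x. lorentz (f x) (g x))"
  unfolding lorentz_def by (intro continuous_intros)

lemma bounded_bilinear_lorentz: "bounded_bilinear lorentz"
proof
  show "\<exists>K. \<forall>a b. norm (lorentz a b) \<le> norm a * norm b * K"
  \<comment> \<open>The time part and the space part are each bounded by the product of the
    norms.\<close>
  proof (intro exI[of _ 2] allI)
    fix a b :: minkowski
    have "\<bar>fst a * fst b\<bar> \<le> norm a * norm b"
      using mult_mono[OF norm_fst_le[of "fst a" "snd a"] norm_fst_le[of "fst b" "snd b"]]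
      by (simp add: abs_mult)
    moreover have "\<bar>snd a \<bullet> snd b\<bar> \<le> norm a * norm b"
      using Cauchy_Schwarz_ineq2[of "snd a" "snd b"]
        mult_mono[OF norm_snd_le[of "snd a" "fst a"] norm_snd_le[of "snd b" "fst b"]] by simp
    ultimately show "norm (lorentz a b) \<le> norm a * norm b * 2"
      unfolding lorentz_def real_norm_def by linarith
  qed
qed (simp_all add: lorentz_simps)

lemmas has_derivative_lorentz = bounded_bilinear.FDERIV[OF bounded_bilinear_lorentz]

section \<open>The area measure\<close>

text \<open>A bridge between the nonnegative integrals in \<open>area_measure\<close> and the gauge
  integral, for which the change of variables is available. The value infinity encodes failure of
  integrability, so an equivalence of integrability settles the infinite case.\<close>

lemma nn_integral_eq_integral_on:
  fixes h :: "'a::euclidean_space \<Rightarrow> real"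
  assumes m: "(\<lambda>x. indicator S x *\<^sub>R h x) \<in> borel_measurable borel" and nn: "\<And>x. x \<in> S \<Longrightarrow> 0 \<le> h x"
  shows "(\<integral>\<^sup>+x. ennreal (h x) * indicator S x \<partial>lborel) =
    (if h absolutely_integrable_on S then ennreal (integral S h) else \<infinity>)"
proof -
  let ?F = "\<lambda>x. indicator S x *\<^sub>R h x"
  have F: "?F \<in> borel_measurable lebesgue" "\<And>x. 0 \<le> ?F x"
    using m nn by (auto simp: indicator_def intro: measurable_completion)
  have "(\<integral>\<^sup>+x. ennreal (h x) * indicator S x \<partial>lborel) = (\<integral>\<^sup>+x. ennreal (?F x) \<partial>lborel)"
    by (intro nn_integral_cong) (auto simp: indicator_def)
  also have "\<dots> = (\<integral>\<^sup>+x. ennreal (?F x) \<partial>lebesgue)"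
    by (simp add: nn_integral_completion)
  finally have *: "(\<integral>\<^sup>+x. ennreal (h x) * indicator S x \<partial>lborel) = (\<integral>\<^sup>+x. ennreal (?F x) \<partial>lebesgue)" .
  show ?thesis
  proof (cases "h absolutely_integrable_on S")
    case True
    then have i: "integrable lebesgue ?F" by (simp add: set_integrable_def)
    have "(\<integral>\<^sup>+x. ennreal (?F x) \<partial>lebesgue) = ennreal (integral\<^sup>L lebesgue ?F)"
      using nn_integral_eq_integral[OF i] F(2) by simp
    also have "integral\<^sup>L lebesgue ?F = integral S h"
      using set_lebesgue_integral_eq_integral(2)[OF True] by (simp add: set_lebesgue_integral_def)
    finally show ?thesis using * True by simp
  next
    case False
    then have "\<not> integrable lebesgue ?F" by (simp add: set_integrable_def)
    then have "(\<integral>\<^sup>+x. ennreal (?F x) \<partial>lebesgue) = \<infinity>"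
      using integrableI_nonneg[OF F(1)] F(2) by (auto simp: less_top[symmetric])
    then show ?thesis using * False by simp
  qed
qed

text \<open>The formula for vector valued functions, applied to a scalar function regarded as a map
  into \<open>real^1\<close>.\<close>

lemma has_absolute_integral_change_of_variables_scalar:
  fixes f :: "real^'m::{finite,wellorder} \<Rightarrow> real" and g :: "real^'m::_ \<Rightarrow> real^'m::_"
  assumes S: "S \<in> sets lebesgue"
    and der: "\<And>x. x \<in> S \<Longrightarrow> (g has_derivative g' x) (at x within S)"
    and inj: "inj_on g S"
  defines "h \<equiv> \<lambda>x. \<bar>det (matrix (g' x))\<bar> * f (g x)"
  shows "h absolutely_integrable_on S \<longleftrightarrow> f absolutely_integrable_on g ` S"
    "f absolutely_integrable_on g ` S \<Longrightarrow> integral S h = integral (g ` S) f"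
proof -
  have vec: "(\<lambda>x. vec (k x) :: real^1) absolutely_integrable_on T \<longleftrightarrow> k absolutely_integrable_on T"
    for k :: "real^'m::_ \<Rightarrow> real" and T
    by (subst absolutely_integrable_componentwise_iff) (auto simp: Basis_vec_def inner_axis)
  have vec_int: "integral T k = integral T (\<lambda>x. vec (k x) :: real^1) $ 1"
    if "k absolutely_integrable_on T" for k :: "real^'m::_ \<Rightarrow> real" and T
  proof -
    have "(\<lambda>x. vec (k x) :: real^1) integrable_on T"
      using that vec set_lebesgue_integral_eq_integral(1) by blast
    from integral_component_eq_cart[OF this, of 1] show ?thesis by simp
  qed
  have h: "(\<lambda>x. \<bar>det (matrix (g' x))\<bar> *\<^sub>R (vec (f (g x)) :: real^1)) = (\<lambda>x. vec (h x))"
    by (auto simp: h_def vec_eq_iff)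
  note cov = has_absolute_integral_change_of_variables[OF S der inj, of "\<lambda>x. vec (f x) :: real^1", unfolded h]
  show iff: "h absolutely_integrable_on S \<longleftrightarrow> f absolutely_integrable_on g ` S"
    using cov vec by blast
  show "integral S h = integral (g ` S) f" if "f absolutely_integrable_on g ` S"
    using cov vec_int[OF that] vec_int[OF iff[THEN iffD2, OF that]] vec that by metis
qed

text \<open>The two integrands are absolutely integrable together or not at all: in the first case
  the substitution formula applies, in the second both sides are infinite.\<close>

lemma nn_integral_change_of_variables:
  fixes f :: "real^'m::{finite,wellorder} \<Rightarrow> real" and g :: "real^'m::_ \<Rightarrow> real^'m::_"
  assumes S: "S \<in> sets borel"
    and der: "\<And>x. x \<in> S \<Longrightarrow> (g has_derivative g' x) (at x within S)"
    and inj: "inj_on g S"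
    and nn: "\<And>y. y \<in> g ` S \<Longrightarrow> 0 \<le> f y"
    and f: "(\<lambda>y. indicator (g ` S) y *\<^sub>R f y) \<in> borel_measurable borel"
    and h: "\<And>x. x \<in> S \<Longrightarrow> h x = \<bar>det (matrix (g' x))\<bar> * f (g x)"
    and h': "(\<lambda>x. indicator S x *\<^sub>R h x) \<in> borel_measurable borel"
  shows "(\<integral>\<^sup>+x. ennreal (h x) * indicator S x \<partial>lborel) =
    (\<integral>\<^sup>+y. ennreal (f y) * indicator (g ` S) y \<partial>lborel)"
proof -
  let ?h = "\<lambda>x. \<bar>det (matrix (g' x))\<bar> * f (g x)"
  have "S \<in> sets lebesgue" using S by auto
  note cov = has_absolute_integral_change_of_variables_scalar[OF this der inj, of f]
  have "h absolutely_integrable_on S \<longleftrightarrow> ?h absolutely_integrable_on S"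
    using h by (intro set_integrable_cong) auto
  moreover have "integral S h = integral S ?h"
    using h by (intro integral_cong) auto
  moreover have "0 \<le> h x" if "x \<in> S" for x
    using that nn h by simp
  ultimately show ?thesis
    using cov nn_integral_eq_integral_on[OF f nn] nn_integral_eq_integral_on[OF h'] by simp
qed

section \<open>Gluing measures along a countable cover\<close>

lemma suminf_swap_ennreal:
  fixes f :: "nat \<Rightarrow> nat \<Rightarrow> ennreal"
  shows "(\<Sum>i. \<Sum>j. f i j) = (\<Sum>j. \<Sum>i. f i j)"
proof -
  have "(\<Sum>i. \<Sum>j. f i j) = (\<integral>\<^sup>+i. (\<Sum>j. f i j) \<partial>count_space UNIV)"
    by (simp add: nn_integral_count_space_nat)
  also have "\<dots> = (\<Sum>j. \<integral>\<^sup>+i. f i j \<partial>count_space UNIV)"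
    by (rule nn_integral_suminf) simp
  finally show ?thesis by (simp add: nn_integral_count_space_nat)
qed

text \<open>Make the countable cover disjoint. Every measurable \<open>B\<close> splits into
  countably many pieces, each inside one \<open>C i\<close>, so the local measures force the value
  on \<open>B\<close>; this gives uniqueness and also the definition \<open>m\<close>. Compatibility
  shows that \<open>m\<close> agrees with every local measure, including those outside the countable
  subfamily.\<close>

lemma glue_measures:
  fixes M :: "'i \<Rightarrow> 'a measure"
  assumes "sigma_algebra \<Omega> \<M>" and C: "\<And>i. i \<in> I \<Longrightarrow> C i \<in> \<M>"
    and M: "\<And>i. i \<in> I \<Longrightarrow> sets (M i) = \<M>"
    and compat: "\<And>i j B. i \<in> I \<Longrightarrow> j \<in> I \<Longrightarrow> B \<in> \<M> \<Longrightarrow> B \<subseteq> C i \<Longrightarrow> B \<subseteq> C j \<Longrightarrow>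
      emeasure (M i) B = emeasure (M j) B"
    and J: "countable J" "J \<subseteq> I" "(\<Union>i\<in>J. C i) = \<Omega>" "\<Omega> \<noteq> {}"
  shows "\<exists>!\<mu>. space \<mu> = \<Omega> \<and> sets \<mu> = \<M> \<and>
    (\<forall>i\<in>I. \<forall>B\<in>\<M>. B \<subseteq> C i \<longrightarrow> emeasure \<mu> B = emeasure (M i) B)"
proof -
  interpret sigma_algebra \<Omega> \<M> by fact
  \<comment> \<open>For finite \<open>J\<close> the enumeration repeats members; a repeated set
    contributes an empty member to the disjoint family.\<close>
  define e where "e = from_nat_into J"
  have "J \<noteq> {}" using J by auto
  then have range_e: "range e = J"
    using J(1) unfolding e_def by (simp add: range_from_nat_into)
  have e: "e n \<in> I" for n using range_e J(2) by auto
  define D where "D = disjointed (\<lambda>n. C (e n))"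
  have D_sub: "D n \<subseteq> C (e n)" for n
    unfolding D_def by (rule disjointed_subset)
  have D_disj: "disjoint_family D"
    unfolding D_def by (rule disjoint_family_disjointed)
  have D_sets: "D n \<in> \<M>" for n
    using range_disjointed_sets[of "\<lambda>n. C (e n)"] C[OF e] unfolding D_def by blast
  have D_UN: "(\<Union>n. D n) = \<Omega>"
    unfolding D_def UN_disjointed_eq using J(3) range_e by (metis image_image)
  have split: "B = (\<Union>n. B \<inter> D n)" "disjoint_family (\<lambda>n. B \<inter> D n)" if "B \<in> \<M>" for B
    using D_UN sets_into_space[OF that] D_disj by (auto simp: disjoint_family_on_def)
  have decompose: "emeasure \<mu> B = (\<Sum>n. emeasure \<mu> (B \<inter> D n))" if "sets \<mu> = \<M>" "B \<in> \<M>" for \<mu> B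
  proof -
    have "range (\<lambda>n. B \<inter> D n) \<subseteq> sets \<mu>" using that D_sets by auto
    from suminf_emeasure[OF this split(2)[OF that(2)]] split(1)[OF that(2)] show ?thesis by metis
  qed
  define m where "m B = (\<Sum>n. emeasure (M (e n)) (B \<inter> D n))" for B
  define \<mu> where "\<mu> = measure_of \<Omega> \<M> m"
  have sp: "space \<mu> = \<Omega>" "sets \<mu> = \<M>"
    unfolding \<mu>_def using space_closed sets_measure_of[OF space_closed] sigma_sets_eq by auto
  have "countably_additive \<M> m"
  proof (rule countably_additiveI)
    fix F :: "nat \<Rightarrow> 'a set"
    assume F: "range F \<subseteq> \<M>" "disjoint_family F" "(\<Union>i. F i) \<in> \<M>"
    have "(\<Sum>i. emeasure (M (e n)) (F i \<inter> D n)) = emeasure (M (e n)) ((\<Union>i. F i) \<inter> D n)" for n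
    proof -
      have "range (\<lambda>i. F i \<inter> D n) \<subseteq> sets (M (e n))" using F(1) D_sets M[OF e] by auto
      moreover have "disjoint_family (\<lambda>i. F i \<inter> D n)" using F(2) by (auto simp: disjoint_family_on_def)
      ultimately show ?thesis using suminf_emeasure by (metis Int_UN_distrib2 UN_extend_simps(4))
    qed
    then show "(\<Sum>i. m (F i)) = m (\<Union>i. F i)"
      unfolding m_def by (subst suminf_swap_ennreal) simp
  qed
  moreover have "positive \<M> m" unfolding positive_def m_def by simp
  ultimately have em: "emeasure \<mu> B = m B" if "B \<in> \<M>" for B
    using emeasure_measure_of[OF \<mu>_def space_closed] sp that by simp
  show ?thesis
  proof (intro ex1I[of _ \<mu>] conjI ballI impI sp)
    fix i B assume i: "i \<in> I" "B \<in> \<M>" "B \<subseteq> C i"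
    have "emeasure (M (e n)) (B \<inter> D n) = emeasure (M i) (B \<inter> D n)" for n
      using compat[OF e i(1), of "B \<inter> D n" n] D_sub[of n] D_sets i by blast
    then show "emeasure \<mu> B = emeasure (M i) B"
      using em[OF i(2)] decompose[OF M[OF i(1)] i(2)] by (simp add: m_def)
  next
    fix \<nu> assume \<nu>: "space \<nu> = \<Omega> \<and> sets \<nu> = \<M> \<and>
      (\<forall>i\<in>I. \<forall>B\<in>\<M>. B \<subseteq> C i \<longrightarrow> emeasure \<nu> B = emeasure (M i) B)"
    show "\<nu> = \<mu>"
    proof (rule measure_eqI)
      show "sets \<nu> = sets \<mu>" using \<nu> sp by simp
      fix B assume "B \<in> sets \<nu>"
      then have B: "B \<in> \<M>" using \<nu> by simp
      have "emeasure \<nu> (B \<inter> D n) = emeasure (M (e n)) (B \<inter> D n)" for n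
        using \<nu> e[of n] D_sub[of n] D_sets B by blast
      then show "emeasure \<nu> B = emeasure \<mu> B"
        using em[OF B] decompose[of \<nu>, OF _ B] \<nu> by (simp add: m_def)
    qed
  qed
qed

section \<open>Borel sets of an abstract topology\<close>

abbreviation borel_sets :: "'a topology \<Rightarrow> 'a set set" where
  "borel_sets S \<equiv> sigma_sets (topspace S) {W. openin S W}"

text \<open>Only a carrier of measurable sets, with zero measure. It makes a topology that is a
  value, not a type class instance, usable in \<open>measurable\<close> and
  \<open>distr\<close>.\<close>

abbreviation borel_space :: "'a topology \<Rightarrow> 'a measure" where
  "borel_space S \<equiv> sigma (topspace S) {W. openin S W}"

lemma openin_subset_Pow: "{W. openin S W} \<subseteq> Pow (topspace S)"
  by (auto dest: openin_subset)

lemma sets_borel_space: "sets (borel_space S) = borel_sets S"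
  using sets_measure_of[OF openin_subset_Pow] .

lemma space_borel_space: "space (borel_space S) = topspace S"
  using space_measure_of[OF openin_subset_Pow] .

lemma measurable_into_borel_sets:
  assumes "sets N = borel_sets T" "\<And>x. x \<in> space M \<Longrightarrow> f x \<in> topspace T"
    and "\<And>W. openin T W \<Longrightarrow> {x \<in> space M. f x \<in> W} \<in> sets M"
  shows "f \<in> measurable M N"
  using measurable_sigma_sets[OF assms(1) openin_subset_Pow, of f M] assms(2,3)
  by (auto simp: vimage_def Int_def conj_commute)

lemma measurable_continuous_map:
  assumes "continuous_map S T f" "sets M = borel_sets S" "space M = topspace S" "sets N = borel_sets T"
  shows "f \<in> measurable M N"
proof (rule measurable_into_borel_sets[OF assms(4)])
  show "f x \<in> topspace T" if "x \<in> space M" for x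
    using continuous_map_image_subset_topspace[OF assms(1)] that assms(3) by auto
  show "{x \<in> space M. f x \<in> W} \<in> sets M" if "openin T W" for W
    using openin_continuous_map_preimage[OF assms(1) that] assms(2,3) by auto
qed

lemma linear_on_plane:
  assumes "linear (f :: real^2 \<Rightarrow> 'b::real_vector)"
  shows "f \<xi> = \<xi> $ 1 *\<^sub>R f (axis 1 1) + \<xi> $ 2 *\<^sub>R f (axis 2 1)"
proof -
  define a b where "a = \<xi> $ 1" "b = \<xi> $ 2"
  then have "\<xi> = a *\<^sub>R axis 1 1 + b *\<^sub>R axis 2 1"
    by (simp add: vec_eq_iff axis_def forall_2)
  then have "f \<xi> = a *\<^sub>R f (axis 1 1) + b *\<^sub>R f (axis 2 1)"
    using assms by (simp add: linear_add linear_scale)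
  then show ?thesis by (simp add: a_b_def)
qed

section \<open>Area in a chart and its behaviour under a change of chart\<close>

lemma smooth_along_chart:
  assumes "smooth_surface S A" "smooth_along A (topspace S) X" "(U, p) \<in> A"
  shows "smooth_on U (X \<circ> p)"
proof -
  have "{u \<in> U. p u \<in> topspace S} = U"
    using surface_chart(4)[OF assms(1,3)] by auto
  then show ?thesis using assms(2,3) unfolding smooth_along_def by force
qed

text \<open>Under a linear change of the two coordinate vectors the Gram determinant is multiplied
  by the square of the determinant of the change, which is the Jacobian of the transition map; the
  square root turns this into the absolute value.\<close>

lemma area_density_chart_change:
  assumes S: "smooth_surface S A" and "(U, p) \<in> A" "(V, q) \<in> A" and uv: "u \<in> U" "v \<in> V" "p u = q v"
    and d: "(X \<circ> q) differentiable at v"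
  shows "area_density X p u =
    \<bar>det (matrix (frechet_derivative (inv_into V q \<circ> p) (at u)))\<bar> * area_density X q v"
proof -
  let ?J = "frechet_derivative (inv_into V q \<circ> p) (at u)"
  let ?P = "frechet_derivative (X \<circ> p) (at u)" and ?Q = "frechet_derivative (X \<circ> q) (at v)"
  have "linear ?Q" using d linear_frechet_derivative by blast
  note lin = linear_on_plane[OF this]
  define a b c e where abce: "a = ?J (axis 1 1) $ 1" "b = ?J (axis 1 1) $ 2"
    "c = ?J (axis 2 1) $ 1" "e = ?J (axis 2 1) $ 2"
  define d1 d2 where d12: "d1 = ?Q (axis 1 1)" "d2 = ?Q (axis 2 1)"
  have det: "det (matrix ?J) = a * e - c * b"
    by (simp add: det_2 matrix_def abce)
  have P: "?P (axis 1 1) = a *\<^sub>R d1 + b *\<^sub>R d2" "?P (axis 2 1) = c *\<^sub>R d1 + e *\<^sub>R d2"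
    using chart_derivative(2)[OF S assms(2,3) uv d] lin abce d12 by metis+
  have "lorentz (?P (axis 1 1)) (?P (axis 1 1)) * lorentz (?P (axis 2 1)) (?P (axis 2 1)) -
      (lorentz (?P (axis 1 1)) (?P (axis 2 1)))\<^sup>2 =
      (a * e - c * b)\<^sup>2 * (lorentz d1 d1 * lorentz d2 d2 - (lorentz d1 d2)\<^sup>2)"
    unfolding P lorentz_simps lorentz_commute[of d2 d1] by algebra
  then show ?thesis
    unfolding area_density_def Let_def det by (simp add: real_sqrt_mult d12)
qed

lemma continuous_on_area_density:
  assumes "smooth_on U (X \<circ> p)"
  shows "continuous_on U (area_density X p)"
  using smooth_on_continuous[OF smooth_on_frechet_derivative[OF assms]]
  unfolding area_density_def Let_def power2_eq_square by (intro continuous_intros continuous_on_lorentz)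

lemma measurable_chart:
  assumes S: "smooth_surface S A" and "(U, p) \<in> A" and M: "sets M = sets borel"
  shows "p \<in> measurable (restrict_space M U) (borel_space S)"
proof (rule measurable_into_borel_sets[OF sets_borel_space])
  have "space M = UNIV" using sets_eq_imp_space_eq[OF M] by simp
  then have sp: "space (restrict_space M U) = U" by (simp add: space_restrict_space)
  then show "p u \<in> topspace S" if "u \<in> space (restrict_space M U)" for u
    using surface_chart(4)[OF S assms(2)] that by simp
  show "{u \<in> space (restrict_space M U). p u \<in> W} \<in> sets (restrict_space M U)" if "openin S W" for W
    unfolding sp using surface_chart(1)[OF S assms(2)] surface_chart(5)[OF S assms(2) that] M
    by (subst sets_restrict_space_iff) auto
qed

lemma borel_chart_preimage:
  assumes S: "smooth_surface S A" and "(U, p) \<in> A" "B \<in> borel_sets S"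
  shows "{u \<in> U. p u \<in> B} \<in> sets borel"
proof -
  have "p -` B \<inter> space (restrict_space borel U) \<in> sets (restrict_space borel U)"
    using measurable_sets[OF measurable_chart[OF S assms(2) refl]] assms(3)
    by (simp add: sets_borel_space)
  then show ?thesis
    using surface_chart(1)[OF S assms(2)]
    by (subst (asm) sets_restrict_space_iff) (auto simp: space_restrict_space vimage_def Int_def conj_commute)
qed

text \<open>A measure on all of \<open>S\<close>, although its mass lies in the image of the chart,
  so that the local measures share one sigma-algebra as \<open>glue_measures\<close> demands. The
  values of \<open>p\<close> and of the density outside \<open>U\<close> are arbitrary: the
  indicator cuts off the density, and the restriction to \<open>U\<close> makes \<open>p\<close>
  measurable.\<close>

definition chart_measure ::
    "'a topology \<Rightarrow> ('a \<Rightarrow> minkowski) \<Rightarrow> (real^2) set \<Rightarrow> (real^2 \<Rightarrow> 'a) \<Rightarrow> 'a measure" where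
  "chart_measure S X U p =
     distr (restrict_space (density lborel (\<lambda>u. ennreal (area_density X p u) * indicator U u)) U)
       (borel_space S) p"

lemma nn_integral_chart_measure:
  assumes S: "smooth_surface S A" and X: "smooth_along A (topspace S) X" and p: "(U, p) \<in> A"
    and f: "f \<in> borel_measurable (borel_space S)"
  shows "(\<integral>\<^sup>+x. f x \<partial>chart_measure S X U p) =
    (\<integral>\<^sup>+u. ennreal (area_density X p u) * (f (p u) * indicator U u) \<partial>lborel)"
proof -
  let ?d = "\<lambda>u. ennreal (area_density X p u) * indicator U u"
  have U: "U \<in> sets borel" using surface_chart(1)[OF S p] by simp
  have "(\<lambda>u. indicator U u *\<^sub>R area_density X p u) \<in> borel_measurable borel"
    using borel_measurable_continuous_on_indicator[OF U continuous_on_area_density]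
      smooth_along_chart[OF S X p] by blast
  then have "(\<lambda>u. ennreal (indicator U u *\<^sub>R area_density X p u)) \<in> borel_measurable borel"
    by measurable
  also have "(\<lambda>u. ennreal (indicator U u *\<^sub>R area_density X p u)) = ?d"
    by (auto simp: indicator_def)
  finally have d: "?d \<in> borel_measurable lborel" by simp
  have fp: "(\<lambda>u. f (p u) * indicator U u) \<in> borel_measurable lborel"
    using measurable_compose[OF measurable_chart[OF S p refl] f] U
    by (simp add: borel_measurable_restrict_space_iff_ennreal)
  have m: "p \<in> measurable (restrict_space (density lborel ?d) U) (borel_space S)"
    using measurable_chart[OF S p] by simp
  have "(\<integral>\<^sup>+x. f x \<partial>chart_measure S X U p) = (\<integral>\<^sup>+u. f (p u) \<partial>restrict_space (density lborel ?d) U)"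
    unfolding chart_measure_def using f by (simp add: nn_integral_distr[OF m])
  also have "\<dots> = (\<integral>\<^sup>+u. f (p u) * indicator U u \<partial>density lborel ?d)"
    using U by (intro nn_integral_restrict_space) simp
  also have "\<dots> = (\<integral>\<^sup>+u. ?d u * (f (p u) * indicator U u) \<partial>lborel)"
    by (rule nn_integral_density[OF d fp])
  also have "\<dots> = (\<integral>\<^sup>+u. ennreal (area_density X p u) * (f (p u) * indicator U u) \<partial>lborel)"
    by (intro nn_integral_cong) (auto simp: indicator_def)
  finally show ?thesis .
qed

lemma sets_chart_measure: "sets (chart_measure S X U p) = borel_sets S"
  by (simp add: chart_measure_def sets_borel_space)

lemma emeasure_chart_measure:
  assumes "smooth_surface S A" "smooth_along A (topspace S) X" "(U, p) \<in> A" "B \<in> borel_sets S"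
  shows "emeasure (chart_measure S X U p) B =
    (\<integral>\<^sup>+u. ennreal (area_density X p u) * indicator {u \<in> U. p u \<in> B} u \<partial>lborel)"
proof -
  have "emeasure (chart_measure S X U p) B = (\<integral>\<^sup>+x. indicator B x \<partial>chart_measure S X U p)"
    using assms(4) by (simp add: sets_chart_measure)
  also have "\<dots> = (\<integral>\<^sup>+u. ennreal (area_density X p u) * (indicator B (p u) * indicator U u) \<partial>lborel)"
    using assms(4)
    by (intro nn_integral_chart_measure[OF assms(1-3)] borel_measurable_indicator) (simp add: sets_borel_space)
  also have "\<dots> = (\<integral>\<^sup>+u. ennreal (area_density X p u) * indicator {u \<in> U. p u \<in> B} u \<partial>lborel)"
    by (intro nn_integral_cong) (auto simp: indicator_def)
  finally show ?thesis .
qed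

text \<open>The compatibility condition for gluing. Since \<open>B\<close> lies in both images, the
  transition map sends the preimage \<open>P\<close> of \<open>B\<close> under \<open>p\<close>
  bijectively onto the preimage \<open>Q\<close> under \<open>q\<close>, and its Jacobian is the
  ratio of the densities.\<close>

lemma emeasure_chart_measure_eq:
  assumes S: "smooth_surface S A" and X: "smooth_along A (topspace S) X"
    and p: "(U, p) \<in> A" and q: "(V, q) \<in> A" and B: "B \<in> borel_sets S" "B \<subseteq> p ` U" "B \<subseteq> q ` V"
  shows "emeasure (chart_measure S X U p) B = emeasure (chart_measure S X V q) B"
proof -
  let ?\<phi> = "inv_into V q \<circ> p"
  define P where "P = {u \<in> U. p u \<in> B}"
  define Q where "Q = {v \<in> V. q v \<in> B}"
  note t = chart_transition[OF S p q]
  have P_sub: "P \<subseteq> {u \<in> U. p u \<in> q ` V}" using B(3) by (auto simp: P_def)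
  have borel: "P \<in> sets borel" "Q \<in> sets borel"
    using borel_chart_preimage[OF S _ B(1)] p q by (auto simp: P_def Q_def)
  have q_inv: "inv_into V q (q v) = v" if "v \<in> V" for v
    using surface_chart(3)[OF S q] that by simp
  have image: "?\<phi> ` P = Q"
  proof
    show "?\<phi> ` P \<subseteq> Q" using t(3,4) P_sub by (force simp: P_def Q_def)
    show "Q \<subseteq> ?\<phi> ` P"
    proof
      fix v assume v: "v \<in> Q"
      then obtain u where "u \<in> U" "p u = q v" using B(2) by (force simp: Q_def)
      then show "v \<in> ?\<phi> ` P" using v q_inv by (force simp: P_def Q_def)
    qed
  qed
  \<comment> \<open>Without a space-like condition the Gram determinant may be negative, and so is
    then its real square root. Cutting at 0 supplies the sign needed for the change of variables; it
    commutes with the nonnegative Jacobian factor and is invisible after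
    \<open>ennreal\<close>.\<close>
  have meas: "(\<lambda>u. indicator C u *\<^sub>R max 0 (area_density X r u)) \<in> borel_measurable borel"
    if "(W, r) \<in> A" "C \<subseteq> W" "C \<in> sets borel" for W r C
  proof -
    have "continuous_on C (area_density X r)"
      using continuous_on_subset[OF continuous_on_area_density[OF smooth_along_chart[OF S X that(1)]] that(2)] .
    then show ?thesis
      by (intro borel_measurable_continuous_on_indicator that continuous_intros)
  qed
  have "(\<integral>\<^sup>+u. ennreal (max 0 (area_density X p u)) * indicator P u \<partial>lborel) =
    (\<integral>\<^sup>+v. ennreal (max 0 (area_density X q v)) * indicator (?\<phi> ` P) v \<partial>lborel)"
  proof (rule nn_integral_change_of_variables[where g = ?\<phi> and
        g' = "\<lambda>u. frechet_derivative ?\<phi> (at u)"])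
    show "(?\<phi> has_derivative frechet_derivative ?\<phi> (at u)) (at u within P)" if "u \<in> P" for u
    proof -
      have "?\<phi> differentiable (at u)"
        using smooth_on_differentiable[OF t(2)] P_sub that by blast
      then show ?thesis
        unfolding frechet_derivative_works by (rule has_derivative_at_withinI)
    qed
    show "inj_on ?\<phi> P" using t(5) P_sub inj_on_subset by blast
    show "max 0 (area_density X p u) = \<bar>det (matrix (frechet_derivative ?\<phi> (at u)))\<bar> *
        max 0 (area_density X q (?\<phi> u))" if "u \<in> P" for u
    proof -
      have "u \<in> {u \<in> U. p u \<in> q ` V}" using that P_sub by blast
      note t(3)[OF this] t(4)[OF this] this
      then have u: "u \<in> U" "?\<phi> u \<in> V" "p u = q (?\<phi> u)"
        by simp_all
      have "(X \<circ> q) differentiable at (?\<phi> u)"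
        using smooth_on_differentiable[OF smooth_along_chart[OF S X q] u(2)] .
      from area_density_chart_change[OF S p q u this] show ?thesis
        by (simp add: max_def mult_le_0_iff zero_le_mult_iff)
    qed
  qed (use meas[OF p] meas[OF q] image borel in \<open>auto simp: P_def Q_def\<close>)
  moreover have "ennreal (max 0 x) = ennreal x" for x
    by (simp add: max_def ennreal_neg)
  ultimately show ?thesis
    using emeasure_chart_measure[OF S X p B(1)] emeasure_chart_measure[OF S X q B(1)] image
    by (simp add: P_def Q_def)
qed

section \<open>Existence, uniqueness and transport of the area measure\<close>

definition is_area_measure :: "'a topology \<Rightarrow> 'a atlas \<Rightarrow> ('a \<Rightarrow> minkowski) \<Rightarrow> 'a measure \<Rightarrow> bool" where
  "is_area_measure S A X \<mu> \<longleftrightarrow> space \<mu> = topspace S \<and> sets \<mu> = borel_sets S \<and>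
     (\<forall>(U, p)\<in>A. \<forall>B\<in>sets \<mu>. B \<subseteq> p ` U \<longrightarrow>
        emeasure \<mu> B =
          (\<integral>\<^sup>+u. ennreal (area_density X p u) * indicator {u \<in> U. p u \<in> B} u \<partial>lborel))"

lemma area_measure_eqI:
  assumes "is_area_measure S A X \<mu>" "\<And>\<nu>. is_area_measure S A X \<nu> \<Longrightarrow> \<nu> = \<mu>"
  shows "area_measure S A X = \<mu>"
  unfolding area_measure_def is_area_measure_def[symmetric] using assms by (rule the_equality)

text \<open>The atlas may be uncountable, but a second countable space is Lindelof, so countably
  many charts cover the surface and \<open>glue_measures\<close> applies.\<close>

lemma ex1_area_measure:
  assumes S: "smooth_surface S A" and ne: "topspace S \<noteq> {}" and X: "smooth_along A (topspace S) X"
  shows "\<exists>!\<mu>. is_area_measure S A X \<mu>"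
proof -
  let ?C = "\<lambda>(U, p). p ` U"
  have cover: "(\<Union>i\<in>A. ?C i) = topspace S" and "second_countable S"
    using S unfolding smooth_surface_def by auto
  then have "Lindelof_space S" by (simp add: second_countable_imp_Lindelof_space)
  moreover have "\<forall>W\<in>?C ` A. openin S W" using surface_chart(2)[OF S] by auto
  ultimately obtain \<V> where \<V>: "countable \<V>" "\<V> \<subseteq> ?C ` A" "\<Union>\<V> = topspace S"
    using cover unfolding Lindelof_space_def by meson
  \<comment> \<open>One chart is chosen for each set of the subcover, so the family of charts is
    countable as well.\<close>
  then obtain J where J: "J \<subseteq> A" "countable J" "\<V> = ?C ` J"
    using countable_subset_image[of \<V> ?C A] by auto
  have eq: "is_area_measure S A X \<mu> \<longleftrightarrow> space \<mu> = topspace S \<and> sets \<mu> = borel_sets S \<and>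
    (\<forall>i\<in>A. \<forall>B\<in>borel_sets S. B \<subseteq> ?C i \<longrightarrow>
      emeasure \<mu> B = emeasure ((\<lambda>(U, p). chart_measure S X U p) i) B)" for \<mu>
    unfolding is_area_measure_def using emeasure_chart_measure[OF S X] by (auto split: prod.splits)
  show ?thesis
    unfolding eq
  proof (rule glue_measures)
    show "sigma_algebra (topspace S) (borel_sets S)"
      by (rule sigma_algebra_sigma_sets[OF openin_subset_Pow])
    show "?C i \<in> borel_sets S" if "i \<in> A" for i
      using surface_chart(2)[OF S] that by (auto split: prod.splits)
    show "sets ((\<lambda>(U, p). chart_measure S X U p) i) = borel_sets S" for i
      by (simp add: sets_chart_measure split: prod.splits)
    show "emeasure ((\<lambda>(U, p). chart_measure S X U p) i) B = emeasure ((\<lambda>(U, p). chart_measure S X U p) j) B"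
      if "i \<in> A" "j \<in> A" "B \<in> borel_sets S" "B \<subseteq> ?C i" "B \<subseteq> ?C j" for i j B
      using emeasure_chart_measure_eq[OF S X, of "fst i" "snd i" "fst j" "snd j" B] that
      by (simp add: case_prod_unfold)
    show "(\<Union>i\<in>J. ?C i) = topspace S" using \<V>(3) J(3) by simp
  qed (use J ne in auto)
qed

lemma is_area_measure_area_measure:
  assumes "smooth_surface S A" "topspace S \<noteq> {}" "smooth_along A (topspace S) X"
  shows "is_area_measure S A X (area_measure S A X)"
  using theI'[OF ex1_area_measure[OF assms]] unfolding area_measure_def is_area_measure_def .

lemma area_measure_unique:
  assumes "smooth_surface S A" "topspace S \<noteq> {}" "smooth_along A (topspace S) X" "is_area_measure S A X \<mu>"
  shows "area_measure S A X = \<mu>"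
  using ex1_area_measure[OF assms(1-3)] is_area_measure_area_measure[OF assms(1-3)] assms(4) by blast

text \<open>By definition \<open>\<mu>\<close> and the chart measure agree on all measurable subsets
  of \<open>B\<close>. Cut down to \<open>B\<close> by an indicator density they are therefore equal
  measures, and have the same integrals.\<close>

lemma nn_integral_area_measure_chart:
  assumes S: "smooth_surface S A" and X: "smooth_along A (topspace S) X"
    and \<mu>: "is_area_measure S A X \<mu>" and p: "(U, p) \<in> A"
    and f: "f \<in> borel_measurable (borel_space S)" and B: "B \<in> borel_sets S" "B \<subseteq> p ` U"
  shows "(\<integral>\<^sup>+x. f x * indicator B x \<partial>\<mu>) =
    (\<integral>\<^sup>+u. ennreal (area_density X p u) * (f (p u) * indicator {u \<in> U. p u \<in> B} u) \<partial>lborel)"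
proof -
  let ?M = "chart_measure S X U p"
  have sets: "sets \<mu> = borel_sets S" using \<mu> unfolding is_area_measure_def by simp
  have "density \<mu> (indicator B) = density ?M (indicator B)"
  proof (rule measure_eqI)
    fix C assume "C \<in> sets (density \<mu> (indicator B))"
    then have C: "C \<in> borel_sets S" using sets by simp
    then have "B \<inter> C \<in> borel_sets S"
      using B(1) sets_borel_space[of S] by (metis sets.Int)
    then have "emeasure \<mu> (B \<inter> C) = emeasure ?M (B \<inter> C)"
      using \<mu> p B(2) emeasure_chart_measure[OF S X p] unfolding is_area_measure_def by fastforce
    then show "emeasure (density \<mu> (indicator B)) C = emeasure (density ?M (indicator B)) C"
      using emeasure_restricted[of B \<mu> C] emeasure_restricted[of B ?M C] B(1) C
      by (simp add: sets sets_chart_measure)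
  qed (simp add: sets sets_chart_measure)
  then have "(\<integral>\<^sup>+x. f x \<partial>density \<mu> (indicator B)) = (\<integral>\<^sup>+x. f x \<partial>density ?M (indicator B))"
    by simp
  moreover have "f \<in> borel_measurable N" if "sets N = borel_sets S" for N
    using f that measurable_cong_sets[of N "borel_space S" borel borel] sets_borel_space by metis
  then have "(\<integral>\<^sup>+x. f x \<partial>density N (indicator B)) = (\<integral>\<^sup>+x. indicator B x * f x \<partial>N)"
    if "sets N = borel_sets S" for N
    using that B(1) by (intro nn_integral_density borel_measurable_indicator) simp_all
  ultimately have "(\<integral>\<^sup>+x. indicator B x * f x \<partial>\<mu>) = (\<integral>\<^sup>+x. indicator B x * f x \<partial>?M)"
    using sets sets_chart_measure by metis
  then have "(\<integral>\<^sup>+x. f x * indicator B x \<partial>\<mu>) = (\<integral>\<^sup>+x. f x * indicator B x \<partial>?M)"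
    by (simp add: mult.commute)
  also have "\<dots> = (\<integral>\<^sup>+u. ennreal (area_density X p u) * (f (p u) * indicator B (p u) * indicator U u) \<partial>lborel)"
    using B(1) f
    by (intro nn_integral_chart_measure[OF S X p] borel_measurable_times_ennreal borel_measurable_indicator)
      (simp_all add: sets_borel_space)
  also have "\<dots> = (\<integral>\<^sup>+u. ennreal (area_density X p u) * (f (p u) * indicator {u \<in> U. p u \<in> B} u) \<partial>lborel)"
    by (intro nn_integral_cong) (auto simp: indicator_def)
  finally show ?thesis .
qed

text \<open>By uniqueness it is enough that the measure on the right satisfies the chart formula for
  \<open>Y\<close>, and there the factor \<open>R\<close> turns one density into the other.\<close>

lemma area_measure_density:
  assumes S: "smooth_surface S A" and ne: "topspace S \<noteq> {}"
    and X: "smooth_along A (topspace S) X" and Y: "smooth_along A (topspace S) Y"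
    and R: "R \<in> borel_measurable (borel_space S)"
    and dens: "\<And>U p u. (U, p) \<in> A \<Longrightarrow> u \<in> U \<Longrightarrow> area_density Y p u = R (p u) * area_density X p u"
    and R0: "\<And>x. x \<in> topspace S \<Longrightarrow> 0 \<le> R x"
  shows "area_measure S A Y = density (area_measure S A X) R"
proof (rule area_measure_unique[OF S ne Y])
  let ?\<mu> = "area_measure S A X"
  have \<mu>: "is_area_measure S A X ?\<mu>" by (rule is_area_measure_area_measure[OF S ne X])
  then have sets: "sets ?\<mu> = borel_sets S" "space ?\<mu> = topspace S"
    unfolding is_area_measure_def by auto
  have "R \<in> borel_measurable ?\<mu>"
    using R measurable_cong_sets[of ?\<mu> "borel_space S" borel borel] sets(1) sets_borel_space by metis
  with R have R': "(\<lambda>x. ennreal (R x)) \<in> borel_measurable ?\<mu>"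
      "(\<lambda>x. ennreal (R x)) \<in> borel_measurable (borel_space S)"
    by measurable
  have "emeasure (density ?\<mu> R) B =
      (\<integral>\<^sup>+u. ennreal (area_density Y p u) * indicator {u \<in> U. p u \<in> B} u \<partial>lborel)"
    if p: "(U, p) \<in> A" and B: "B \<in> borel_sets S" "B \<subseteq> p ` U" for U p B
  proof -
    have "emeasure (density ?\<mu> R) B = (\<integral>\<^sup>+x. ennreal (R x) * indicator B x \<partial>?\<mu>)"
      using B(1) by (intro emeasure_density R') (simp add: sets)
    also have "\<dots> = (\<integral>\<^sup>+u. ennreal (area_density X p u) *
        (ennreal (R (p u)) * indicator {u \<in> U. p u \<in> B} u) \<partial>lborel)"
      by (rule nn_integral_area_measure_chart[OF S X \<mu> p R'(2) B])
    also have "\<dots> = (\<integral>\<^sup>+u. ennreal (area_density Y p u) * indicator {u \<in> U. p u \<in> B} u \<partial>lborel)"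
      using dens[OF p] R0 surface_chart(4)[OF S p]
      by (intro nn_integral_cong) (auto simp: indicator_def ennreal_mult' mult.commute)
    finally show ?thesis .
  qed
  then show "is_area_measure S A Y (density ?\<mu> R)"
    unfolding is_area_measure_def by (auto simp: sets)
qed

text \<open>The immersion \<open>id\<close> in the chart \<open>Y \<circ> p\<close> has the same
  coordinate vectors as \<open>Y\<close> in the chart \<open>p\<close>, so the densities coincide
  and the pushforward is an area measure of the image. Any other candidate is pulled back with the
  inverse \<open>g\<close>; uniqueness on \<open>S\<close> identifies the pullback with the area
  measure there.\<close>

lemma area_measure_image:
  assumes S: "smooth_surface S A" and ne: "topspace S \<noteq> {}"
    and Y: "smooth_along A (topspace S) Y" and emb: "embedding_map S euclidean Y"
  defines "T \<equiv> top_of_set (Y ` topspace S)"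
  shows "area_measure T (image_atlas Y A) id = distr (area_measure S A Y) (borel_space T) Y"
proof -
  have T: "topspace T = Y ` topspace S" by (simp add: T_def)
  have hom: "homeomorphic_map S T Y"
    using emb unfolding embedding_map_def T_def by simp
  then obtain g where g: "homeomorphic_maps S T Y g"
    using homeomorphic_map_maps by blast
  have cont: "continuous_map S T Y" "continuous_map T S g"
    and gY: "\<And>x. x \<in> topspace S \<Longrightarrow> g (Y x) = x" and Yg: "\<And>y. y \<in> topspace T \<Longrightarrow> Y (g y) = y"
    using g unfolding homeomorphic_maps_def by auto
  let ?\<mu> = "area_measure S A Y"
  have \<mu>: "is_area_measure S A Y ?\<mu>" by (rule is_area_measure_area_measure[OF S ne Y])
  then have sp: "space ?\<mu> = topspace S" "sets ?\<mu> = borel_sets S"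
    unfolding is_area_measure_def by auto
  have pre: "{x \<in> topspace S. Y x \<in> B} \<in> borel_sets S" if "B \<in> borel_sets T" for B
    using measurable_sets[OF measurable_continuous_map[OF cont(1) sp(2,1) sets_borel_space[of T]], of B] that sp
    by (simp add: sets_borel_space vimage_def Int_def conj_commute)
  have pre': "{y \<in> topspace T. g y \<in> B} \<in> borel_sets T" if "B \<in> borel_sets S" for B
    using measurable_sets[OF measurable_continuous_map[OF cont(2) sets_borel_space space_borel_space sets_borel_space], of B] that
    by (simp add: sets_borel_space space_borel_space vimage_def Int_def conj_commute)
  have pull: "{x \<in> topspace S. Y x \<in> B} \<subseteq> p ` U \<and> {u \<in> U. p u \<in> {x \<in> topspace S. Y x \<in> B}} = {u \<in> U. Y (p u) \<in> B}"
    if "(U, p) \<in> A" "B \<subseteq> (\<lambda>u. Y (p u)) ` U" for U p B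
  proof -
    have "x \<in> p ` U" if x: "x \<in> topspace S" "Y x \<in> B" for x
    proof -
      obtain u where "u \<in> U" "Y x = Y (p u)" using x \<open>B \<subseteq> _\<close> by auto
      then have "x = p u" using gY x surface_chart(4)[OF S \<open>(U, p) \<in> A\<close>] by metis
      then show ?thesis using \<open>u \<in> U\<close> by simp
    qed
    then show ?thesis using surface_chart(4)[OF S that(1)] by auto
  qed
  have dens: "area_density id (Y \<circ> p) = area_density Y p" for p :: "real^2 \<Rightarrow> 'a"
    by (simp add: area_density_def fun_eq_iff)
  show ?thesis
  proof (rule area_measure_eqI)
    have "emeasure (distr ?\<mu> (borel_space T) Y) B = emeasure ?\<mu> {x \<in> topspace S. Y x \<in> B}"
      if "B \<in> borel_sets T" for B
      using that sp measurable_continuous_map[OF cont(1) sp(2,1) sets_borel_space]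
      by (subst emeasure_distr) (auto simp: sets_borel_space vimage_def Int_def conj_commute)
    moreover have "emeasure ?\<mu> {x \<in> topspace S. Y x \<in> B} =
        (\<integral>\<^sup>+u. ennreal (area_density Y p u) * indicator {u \<in> U. Y (p u) \<in> B} u \<partial>lborel)"
      if "(U, p) \<in> A" "B \<in> borel_sets T" "B \<subseteq> (\<lambda>u. Y (p u)) ` U" for U p B
      using \<mu> pull[OF that(1,3)] pre[OF that(2)] that(1) unfolding is_area_measure_def by fastforce
    ultimately show "is_area_measure T (image_atlas Y A) id (distr ?\<mu> (borel_space T) Y)"
      unfolding is_area_measure_def image_atlas_def
      by (auto simp: sets_borel_space space_borel_space dens)
  next
    fix \<nu> assume \<nu>: "is_area_measure T (image_atlas Y A) id \<nu>"
    then have sp': "space \<nu> = topspace T" "sets \<nu> = borel_sets T"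
      unfolding is_area_measure_def by auto
    have gm: "g \<in> measurable \<nu> (borel_space S)"
      by (rule measurable_continuous_map[OF cont(2) sp'(2,1) sets_borel_space])
    have em: "emeasure (distr \<nu> (borel_space S) g) B = emeasure \<nu> {y \<in> topspace T. g y \<in> B}"
      if "B \<in> borel_sets S" for B
      using that sp' gm by (subst emeasure_distr) (auto simp: sets_borel_space vimage_def Int_def conj_commute)
    have "emeasure \<nu> {y \<in> topspace T. g y \<in> B} =
        (\<integral>\<^sup>+u. ennreal (area_density Y p u) * indicator {u \<in> U. p u \<in> B} u \<partial>lborel)"
      if p: "(U, p) \<in> A" and B: "B \<in> borel_sets S" "B \<subseteq> p ` U" for U p B
    proof -
      have "{y \<in> topspace T. g y \<in> B} \<subseteq> (Y \<circ> p) ` U" using B(2) Yg by force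
      moreover have "{u \<in> U. (Y \<circ> p) u \<in> {y \<in> topspace T. g y \<in> B}} = {u \<in> U. p u \<in> B}"
      proof -
        have "g (Y (p u)) = p u" "Y (p u) \<in> topspace T" if "u \<in> U" for u
          using gY surface_chart(4)[OF S p that] T by auto
        then show ?thesis by auto
      qed
      moreover have "(U, Y \<circ> p) \<in> image_atlas Y A" using p by (force simp: image_atlas_def)
      ultimately show ?thesis
        using \<nu> pre'[OF B(1)] unfolding is_area_measure_def dens[symmetric] by fastforce
    qed
    with em have "is_area_measure S A Y (distr \<nu> (borel_space S) g)"
      unfolding is_area_measure_def by (auto simp: sets_borel_space space_borel_space)
    then have eq: "?\<mu> = distr \<nu> (borel_space S) g"
      by (rule area_measure_unique[OF S ne Y])
    show "\<nu> = distr ?\<mu> (borel_space T) Y"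
    proof (rule measure_eqI)
      fix B assume "B \<in> sets \<nu>"
      then have B: "B \<in> borel_sets T" using sp' by simp
      then have "B \<subseteq> topspace T"
        using sets.sets_into_space[of B \<nu>] sp' by simp
      then have "{y \<in> topspace T. g y \<in> {x \<in> topspace S. Y x \<in> B}} = B"
        using Yg T gY by auto
      then show "emeasure \<nu> B = emeasure (distr ?\<mu> (borel_space T) Y) B"
        using em[OF pre[OF B]] eq B sp measurable_continuous_map[OF cont(1) sp(2,1) sets_borel_space]
        by (subst emeasure_distr) (auto simp: sets_borel_space vimage_def Int_def conj_commute)
    qed (simp add: sp' sets_borel_space)
  qed
qed

text \<open>With a measurable right inverse \<open>g\<close>, measurability of \<open>f\<close> on
  \<open>N\<close> follows from that of its pullback. If \<open>f\<close> is not measurable, neither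
  integrand is integrable and both sides have the default value 0, so the formula covers every
  \<open>f\<close>.\<close>

lemma integral_distr_bij:
  fixes f :: "'b \<Rightarrow> 'c::{banach, second_countable_topology}"
  assumes Y: "Y \<in> measurable M N" and g: "g \<in> measurable N M" and Yg: "\<And>y. y \<in> space N \<Longrightarrow> Y (g y) = y"
  shows "integral\<^sup>L (distr M N Y) f = integral\<^sup>L M (\<lambda>x. f (Y x))"
proof (cases "f \<in> borel_measurable N")
  case True
  then show ?thesis by (rule integral_distr[OF Y])
next
  case False
  have "(\<lambda>x. f (Y x)) \<notin> borel_measurable M"
  proof
    assume "(\<lambda>x. f (Y x)) \<in> borel_measurable M"
    from measurable_compose[OF g this] have "(\<lambda>y. f (Y (g y))) \<in> borel_measurable N" .
    then have "f \<in> borel_measurable N" by (rule measurable_cong[THEN iffD1, rotated]) (simp add: Yg)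
    then show False using False by simp
  qed
  then have "\<not> integrable M (\<lambda>x. f (Y x))" by auto
  moreover have "\<not> integrable (distr M N Y) f" using False by auto
  ultimately show ?thesis by (simp add: not_integrable_integral_eq)
qed

text \<open>Strict positivity allows division by \<open>R\<close>, so \<open>f\<close> is measurable
  as soon as the product is. In the remaining case both integrals have the default value 0.\<close>

lemma integral_density_pos:
  fixes f :: "'a \<Rightarrow> real"
  assumes R: "R \<in> borel_measurable M" "\<And>x. x \<in> space M \<Longrightarrow> 0 < R x"
  shows "integral\<^sup>L (density M R) f = integral\<^sup>L M (\<lambda>x. R x * f x)"
proof (cases "f \<in> borel_measurable M")
  case True
  then show ?thesis using integral_density[OF True R(1)] R(2) by (force intro: less_imp_le)
next
  case False
  have "(\<lambda>x. R x * f x) \<notin> borel_measurable M"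
  proof
    assume "(\<lambda>x. R x * f x) \<in> borel_measurable M"
    then have "(\<lambda>x. R x * f x / R x) \<in> borel_measurable M" using R(1) by measurable
    then have "f \<in> borel_measurable M"
      by (rule measurable_cong[THEN iffD1, rotated]) (use R(2) in fastforce)
    then show False using False by simp
  qed
  then have "\<not> integrable M (\<lambda>x. R x * f x)" by auto
  moreover have "\<not> integrable (density M R) f" using False by auto
  ultimately show ?thesis by (simp add: not_integrable_integral_eq)
qed

section \<open>Space-like planes\<close>

definition plane :: "minkowski \<Rightarrow> minkowski \<Rightarrow> minkowski set" where
  "plane d1 d2 = {a *\<^sub>R d1 + b *\<^sub>R d2 | a b. True}"

definition gram :: "minkowski \<Rightarrow> minkowski \<Rightarrow> real" where
  "gram d1 d2 = lorentz d1 d1 * lorentz d2 d2 - (lorentz d1 d2)\<^sup>2"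

text \<open>Cramer's rule for the vector of the plane whose products with \<open>d1\<close> and \<open>d2\<close> are \<open>t1\<close> and \<open>t2\<close>.\<close>

definition dual_vector :: "minkowski \<Rightarrow> minkowski \<Rightarrow> real \<Rightarrow> real \<Rightarrow> minkowski" where
  "dual_vector d1 d2 t1 t2 =
     ((lorentz d2 d2 * t1 - lorentz d1 d2 * t2) / gram d1 d2) *\<^sub>R d1 +
     ((lorentz d1 d1 * t2 - lorentz d1 d2 * t1) / gram d1 d2) *\<^sub>R d2"

section \<open>Linear algebra in a nondegenerate plane\<close>

lemma plane_mem: "a *\<^sub>R d1 + b *\<^sub>R d2 \<in> plane d1 d2"
  unfolding plane_def by blast

lemma plane_basis: "d1 \<in> plane d1 d2" "d2 \<in> plane d1 d2"
  using plane_mem[of 1 d1 0 d2] plane_mem[of 0 d1 1 d2] by simp_all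

lemma plane_diff: "v \<in> plane d1 d2 \<Longrightarrow> w \<in> plane d1 d2 \<Longrightarrow> v - w \<in> plane d1 d2"
proof -
  have "(a *\<^sub>R d1 + b *\<^sub>R d2) - (c *\<^sub>R d1 + e *\<^sub>R d2) = (a - c) *\<^sub>R d1 + (b - e) *\<^sub>R d2" for a b c e
    by (simp add: algebra_simps)
  then show "v \<in> plane d1 d2 \<Longrightarrow> w \<in> plane d1 d2 \<Longrightarrow> v - w \<in> plane d1 d2"
    unfolding plane_def by blast
qed

lemma orthogonal_plane:
  "lorentz n d1 = 0 \<Longrightarrow> lorentz n d2 = 0 \<Longrightarrow> Y \<in> plane d1 d2 \<Longrightarrow> lorentz n Y = 0"
  unfolding plane_def by (auto simp: lorentz_simps)

lemma spacelike_plane: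
  assumes "\<And>a b. a \<noteq> 0 \<or> b \<noteq> 0 \<Longrightarrow> 0 < lorentz (a *\<^sub>R d1 + b *\<^sub>R d2) (a *\<^sub>R d1 + b *\<^sub>R d2)"
  shows "0 < lorentz d1 d1" "0 < gram d1 d2"
proof -
  show pos: "0 < lorentz d1 d1" using assms[of 1 0] by simp
  \<comment> \<open>This is the second Gram-Schmidt vector with denominators cleared; its squared
    length exhibits the Gram determinant.\<close>
  have "lorentz ((- lorentz d1 d2) *\<^sub>R d1 + lorentz d1 d1 *\<^sub>R d2) ((- lorentz d1 d2) *\<^sub>R d1 + lorentz d1 d1 *\<^sub>R d2)
    = lorentz d1 d1 * gram d1 d2"
    unfolding lorentz_simps gram_def lorentz_commute[of d2 d1] by algebra
  then show "0 < gram d1 d2"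
    using assms[of "- lorentz d1 d2" "lorentz d1 d1"] pos by (simp add: zero_less_mult_iff)
qed

lemma dual_vector_mem: "dual_vector d1 d2 t1 t2 \<in> plane d1 d2"
  unfolding dual_vector_def by (rule plane_mem)

lemma lorentz_dual_vector:
  assumes "gram d1 d2 \<noteq> 0"
  shows "lorentz (dual_vector d1 d2 t1 t2) d1 = t1" "lorentz (dual_vector d1 d2 t1 t2) d2 = t2"
  using assms unfolding dual_vector_def lorentz_simps lorentz_commute[of d2 d1]
  by (simp add: divide_simps, simp add: gram_def algebra_simps power2_eq_square)+

lemma plane_eq_zero:
  assumes "gram d1 d2 \<noteq> 0" "v \<in> plane d1 d2" "lorentz v d1 = 0" "lorentz v d2 = 0"
  shows "v = 0"
proof -
  obtain a b where v: "v = a *\<^sub>R d1 + b *\<^sub>R d2" using assms(2) unfolding plane_def by blast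
  have eq: "a * lorentz d1 d1 + b * lorentz d1 d2 = 0" "a * lorentz d1 d2 + b * lorentz d2 d2 = 0"
    using assms(3,4) unfolding v lorentz_simps lorentz_commute[of d2 d1] by auto
  have "a * gram d1 d2 = 0" "b * gram d1 d2 = 0"
    using eq unfolding gram_def by algebra+
  then show ?thesis using assms(1) v by simp
qed

lemma plane_coeffs_zero:
  assumes "gram d1 d2 \<noteq> 0" "a *\<^sub>R d1 + b *\<^sub>R d2 = 0"
  shows "a = 0" "b = 0"
proof -
  have "lorentz (a *\<^sub>R d1 + b *\<^sub>R d2) d1 = 0" "lorentz (a *\<^sub>R d1 + b *\<^sub>R d2) d2 = 0"
    unfolding assms(2) lorentz_zero by simp_all
  then have "a * gram d1 d2 = 0" "b * gram d1 d2 = 0"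
    unfolding gram_def lorentz_simps lorentz_commute[of d2 d1] by algebra+
  then show "a = 0" "b = 0" using assms(1) by auto
qed

lemma plane_eqI:
  assumes "gram d1 d2 \<noteq> 0" "v \<in> plane d1 d2" "w \<in> plane d1 d2"
    "lorentz v d1 = lorentz w d1" "lorentz v d2 = lorentz w d2"
  shows "v = w"
  using plane_eq_zero[OF assms(1) plane_diff[OF assms(2,3)]] assms(4,5) by (simp add: lorentz_simps)

text \<open>Subtracting the vector of the plane with the same products against \<open>d1\<close> and
  \<open>d2\<close> leaves a normal vector. Nondegeneracy makes the tangential part unique, since a
  vector of the plane is determined by these two products.\<close>

lemma normal_part_plane:
  assumes "gram d1 d2 \<noteq> 0"
  shows "normal_part (plane d1 d2) v = v - dual_vector d1 d2 (lorentz v d1) (lorentz v d2)"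
  unfolding normal_part_def
proof (rule the_equality)
  let ?n = "v - dual_vector d1 d2 (lorentz v d1) (lorentz v d2)"
  have n: "lorentz ?n d1 = 0" "lorentz ?n d2 = 0"
    using lorentz_dual_vector[OF assms] by (simp_all add: lorentz_simps)
  then show "v - ?n \<in> plane d1 d2 \<and> (\<forall>Y\<in>plane d1 d2. lorentz ?n Y = 0)"
    using orthogonal_plane[OF n] dual_vector_mem[of d1 d2] by simp
  fix m assume m: "v - m \<in> plane d1 d2 \<and> (\<forall>Y\<in>plane d1 d2. lorentz m Y = 0)"
  then have "v - m = dual_vector d1 d2 (lorentz v d1) (lorentz v d2)"
  proof (intro plane_eqI[OF assms] dual_vector_mem)
    have "lorentz m d1 = 0" "lorentz m d2 = 0" using m plane_basis by blast+
    then show "lorentz (v - m) d1 = lorentz (dual_vector d1 d2 (lorentz v d1) (lorentz v d2)) d1"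
      "lorentz (v - m) d2 = lorentz (dual_vector d1 d2 (lorentz v d1) (lorentz v d2)) d2"
      by (simp_all add: lorentz_dual_vector[OF assms] lorentz_diff)
  qed simp
  then show "m = ?n" by (simp add: algebra_simps)
qed

lemma normal_part_linear:
  assumes "gram d1 d2 \<noteq> 0"
  shows "normal_part (plane d1 d2) (v + w) = normal_part (plane d1 d2) v + normal_part (plane d1 d2) w"
    "normal_part (plane d1 d2) (a *\<^sub>R v) = a *\<^sub>R normal_part (plane d1 d2) v"
  unfolding normal_part_plane[OF assms] dual_vector_def lorentz_simps
  by (simp_all add: algebra_simps add_divide_distrib diff_divide_distrib)

lemma normal_part_tangent:
  assumes "gram d1 d2 \<noteq> 0" "v \<in> plane d1 d2"
  shows "normal_part (plane d1 d2) v = 0"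
proof -
  have "v = dual_vector d1 d2 (lorentz v d1) (lorentz v d2)"
    using lorentz_dual_vector[OF assms(1)] by (intro plane_eqI[OF assms dual_vector_mem]) auto
  then show ?thesis unfolding normal_part_plane[OF assms(1)] by simp
qed

lemma lorentz_normal_part:
  assumes "gram d1 d2 \<noteq> 0" "lorentz n d1 = 0" "lorentz n d2 = 0"
  shows "lorentz (normal_part (plane d1 d2) v) n = lorentz v n"
  using orthogonal_plane[OF assms(2,3) dual_vector_mem]
  by (simp add: normal_part_plane[OF assms(1)] lorentz_simps lorentz_commute[of _ n])

text \<open>Let \<open>M\<close> have rows \<open>(a, b)\<close> and \<open>(c, e)\<close>, and let
  \<open>g\<close> be the symmetric matrix with entries \<open>x\<close>, \<open>y\<close>,
  \<open>z\<close>. The hypotheses say that \<open>M g\<close> times the transpose of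
  \<open>M\<close> is the identity, so the transpose of \<open>M\<close> times \<open>M\<close> is
  the inverse of \<open>g\<close>; the claims are its entries multiplied by the determinant of
  \<open>g\<close>.\<close>

lemma orthonormal_frame_coeffs:
  fixes a b c e x y z :: real
  assumes "a * a * x + 2 * a * b * y + b * b * z = 1" "c * c * x + 2 * c * e * y + e * e * z = 1"
    "a * c * x + (a * e + b * c) * y + b * e * z = 0"
  shows "(x * z - y\<^sup>2) * (a * a + c * c) = z" "(x * z - y\<^sup>2) * (b * b + e * e) = x"
    "(x * z - y\<^sup>2) * (a * b + c * e) = - y"
proof -
  have "(a * e - b * c)\<^sup>2 * (x * z - y\<^sup>2) = 1" using assms by algebra
  then show "(x * z - y\<^sup>2) * (a * a + c * c) = z" "(x * z - y\<^sup>2) * (b * b + e * e) = x"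
    "(x * z - y\<^sup>2) * (a * b + c * e) = - y"
    using assms by algebra+
qed

lemma orthonormal_frame_exists:
  assumes pos: "0 < lorentz d1 d1" "0 < gram d1 d2"
  obtains e1 e2 where "orthonormal_frame (plane d1 d2) e1 e2"
proof -
  let ?x = "lorentz d1 d1" and ?y = "lorentz d1 d2"
  define r s where rs: "r = sqrt ?x" "s = sqrt (?x * gram d1 d2)"
  have r: "r * r = ?x" and s: "s * s = ?x * gram d1 d2" and nz: "r \<noteq> 0" "s \<noteq> 0"
    using pos by (simp_all add: rs)
  \<comment> \<open>Gram-Schmidt: \<open>r\<close> and \<open>s\<close> are the lengths of
    \<open>d1\<close> and of the vector used in \<open>spacelike_plane\<close>. The zero summand
    brings \<open>e1\<close> into the form of \<open>plane_mem\<close>.\<close>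
  define e1 e2 where e: "e1 = (1 / r) *\<^sub>R d1 + 0 *\<^sub>R d2" "e2 = (- ?y / s) *\<^sub>R d1 + (?x / s) *\<^sub>R d2"
  have "lorentz e1 e1 * (r * r) = r * r"
    unfolding e r by (simp add: lorentz_simps r[symmetric] nz)
  then have 1: "lorentz e1 e1 = 1" using nz by simp
  have "lorentz e2 e2 * (s * s) = ?x * gram d1 d2"
    unfolding e lorentz_simps lorentz_commute[of d2 d1] gram_def using nz(2)
    by (simp add: divide_simps, simp add: algebra_simps power2_eq_square)
  then have 2: "lorentz e2 e2 = 1" unfolding s[symmetric] using nz by simp
  have 3: "lorentz e1 e2 = 0"
    by (simp add: e lorentz_simps algebra_simps)
  have "orthonormal_frame (plane d1 d2) e1 e2"
    unfolding orthonormal_frame_def using 1 2 3 plane_mem unfolding e by blast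
  then show ?thesis by (rule that)
qed

text \<open>By \<open>orthonormal_frame_coeffs\<close> the coefficients of any orthonormal frame
  enter only through the inverse metric, so the sum does not depend on the frame. The values of
  \<open>B\<close> lie in a general vector space in order to serve both the vector valued second
  fundamental form and the real one with respect to a normal field.\<close>

lemma metric_trace_plane:
  fixes B :: "minkowski \<Rightarrow> minkowski \<Rightarrow> 'b::real_vector"
  assumes pos: "0 < lorentz d1 d1" "0 < gram d1 d2"
    and B: "\<And>a b c e. B (a *\<^sub>R d1 + b *\<^sub>R d2) (c *\<^sub>R d1 + e *\<^sub>R d2) =
      (a * c) *\<^sub>R B11 + (a * e) *\<^sub>R B12 + (b * c) *\<^sub>R B21 + (b * e) *\<^sub>R B22"
  shows "metric_trace (plane d1 d2) B = (1 / gram d1 d2) *\<^sub>R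
    (lorentz d2 d2 *\<^sub>R B11 - lorentz d1 d2 *\<^sub>R (B12 + B21) + lorentz d1 d1 *\<^sub>R B22)"
    (is "_ = ?h")
proof -
  let ?x = "lorentz d1 d1" and ?y = "lorentz d1 d2" and ?z = "lorentz d2 d2" and ?D = "gram d1 d2"
  have *: "B e1 e1 + B e2 e2 = ?h" if frame: "orthonormal_frame (plane d1 d2) e1 e2" for e1 e2
  proof -
    obtain a b c e where e12: "e1 = a *\<^sub>R d1 + b *\<^sub>R d2" "e2 = c *\<^sub>R d1 + e *\<^sub>R d2"
      using frame unfolding orthonormal_frame_def plane_def by blast
    have "a * a * ?x + 2 * a * b * ?y + b * b * ?z = 1" "c * c * ?x + 2 * c * e * ?y + e * e * ?z = 1"
      "a * c * ?x + (a * e + b * c) * ?y + b * e * ?z = 0"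
      using frame unfolding orthonormal_frame_def e12 lorentz_simps lorentz_commute[of d2 d1]
      by (auto simp: algebra_simps)
    note orthonormal_frame_coeffs[OF this, folded gram_def]
    then have "a * a + c * c = ?z / ?D" "b * b + e * e = ?x / ?D" "a * b + c * e = - ?y / ?D"
      using pos(2) by (simp_all add: field_simps)
    moreover have "B e1 e1 + B e2 e2 =
        (a * a + c * c) *\<^sub>R B11 + (a * b + c * e) *\<^sub>R (B12 + B21) + (b * b + e * e) *\<^sub>R B22"
      unfolding e12 B by (simp add: algebra_simps)
    ultimately show ?thesis by (simp add: algebra_simps divide_inverse)
  qed
  moreover obtain e1 e2 where "orthonormal_frame (plane d1 d2) e1 e2"
    using orthonormal_frame_exists[OF pos] .
  ultimately show ?thesis
    unfolding metric_trace_def by (intro the_equality) metis+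
qed

text \<open>Four vectors that are orthonormal for the Lorentzian product are independent, hence span
  the space, so \<open>w\<close> is orthogonal to everything.\<close>

lemma lorentz_orthogonal_basis:
  assumes e: "lorentz e1 e1 = 1" "lorentz e2 e2 = 1" "lorentz e3 e3 = 1" "lorentz e4 e4 = -1"
    and o: "lorentz e1 e2 = 0" "lorentz e1 e3 = 0" "lorentz e1 e4 = 0"
      "lorentz e2 e3 = 0" "lorentz e2 e4 = 0" "lorentz e3 e4 = 0"
    and w: "lorentz w e1 = 0" "lorentz w e2 = 0" "lorentz w e3 = 0" "lorentz w e4 = 0"
  shows "w = 0"
proof -
  let ?B = "{e1, e2, e3, e4}"
  have o': "lorentz e2 e1 = 0" "lorentz e3 e1 = 0" "lorentz e4 e1 = 0"
      "lorentz e3 e2 = 0" "lorentz e4 e2 = 0" "lorentz e4 e3 = 0"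
    using o by (simp_all add: lorentz_commute)
  have dist: "e1 \<noteq> e2" "e1 \<noteq> e3" "e1 \<noteq> e4" "e2 \<noteq> e3" "e2 \<noteq> e4" "e3 \<noteq> e4"
    using e o by auto
  have lin: "linear (\<lambda>v. lorentz v z)" for z
    by (rule linearI) (simp_all add: lorentz_simps)
  have "independent ?B"
  proof (rule independent_if_scalars_zero)
    fix f z assume sum: "(\<Sum>v\<in>?B. f v *\<^sub>R v) = 0" and z: "z \<in> ?B"
    have "f e1 *\<^sub>R e1 + (f e2 *\<^sub>R e2 + (f e3 *\<^sub>R e3 + f e4 *\<^sub>R e4)) = 0"
      using sum dist by simp
    then have "lorentz (f e1 *\<^sub>R e1 + (f e2 *\<^sub>R e2 + (f e3 *\<^sub>R e3 + f e4 *\<^sub>R e4))) z = 0"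
      by (simp add: lorentz_simps)
    then show "f z = 0"
      using z e o o' by (auto simp: lorentz_simps)
  qed simp
  moreover have "card ?B = DIM(minkowski)"
    using dist by simp
  ultimately have "span ?B = UNIV"
    using card_ge_dim_independent[of ?B UNIV] by auto
  moreover have "lorentz v w = 0" if "v \<in> span ?B" for v
    using linear_eq_0_on_span[OF lin[of w], of ?B v] w that by (auto simp: lorentz_commute[of _ w])
  \<comment> \<open>Reversing the time component of one factor turns the Lorentzian square into the
    Euclidean one.\<close>
  ultimately have "lorentz (- fst w, snd w) w = 0" by simp
  then have "(fst w)\<^sup>2 + (norm (snd w))\<^sup>2 = 0"
    by (simp add: lorentz_def power2_eq_square dot_square_norm)
  then show "w = 0"
    by (simp add: sum_power2_eq_zero_iff prod_eq_iff)
qed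

text \<open>A time-like unit vector has a space part shorter than its time component, so by
  Cauchy-Schwarz the product of the time components prevails.\<close>

lemma future_timelike_lorentz_neg:
  assumes "lorentz v v = -1" "fst v > 0" "lorentz w w = -1" "fst w > 0"
  shows "lorentz v w < 0"
proof -
  have "(norm (snd v))\<^sup>2 < (fst v)\<^sup>2" "(norm (snd w))\<^sup>2 < (fst w)\<^sup>2"
    using assms(1,3) by (simp_all add: lorentz_def dot_square_norm power2_eq_square)
  then have "norm (snd v) < fst v" "norm (snd w) < fst w"
    using assms(2,4) by (simp_all add: power2_less_imp_less)
  then have "norm (snd v) * norm (snd w) < fst v * fst w"
    using assms(2,4) by (intro mult_strict_mono) auto
  then show ?thesis
    using norm_cauchy_schwarz[of "snd v" "snd w"] unfolding lorentz_def by linarith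
qed

text \<open>The vectors orthogonal to the plane and to \<open>n\<close> form a line, so
  \<open>w\<close> is a multiple of \<open>v\<close>. The unit length leaves two signs, and the sign
  of the product decides.\<close>

lemma future_timelike_unique:
  assumes v: "lorentz v v = -1" and w: "lorentz w w = -1" and pos: "lorentz v w < 0"
    and o: "lorentz v d1 = 0" "lorentz v d2 = 0" "lorentz v n = 0"
      "lorentz w d1 = 0" "lorentz w d2 = 0" "lorentz w n = 0"
    and n: "lorentz n n = 1" "lorentz n d1 = 0" "lorentz n d2 = 0"
    and frame: "orthonormal_frame (plane d1 d2) e1 e2"
  shows "w = v"
proof -
  let ?c = "lorentz v w"
  have e: "e1 \<in> plane d1 d2" "e2 \<in> plane d1 d2" "lorentz e1 e1 = 1" "lorentz e2 e2 = 1" "lorentz e1 e2 = 0"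
    using frame unfolding orthonormal_frame_def by auto
  have oe: "lorentz m e1 = 0" "lorentz m e2 = 0" if "lorentz m d1 = 0" "lorentz m d2 = 0" for m
    using orthogonal_plane[OF that] e by auto
  \<comment> \<open>Removal of the component along \<open>v\<close>; the sign is plus because
    \<open>v\<close> has square -1.\<close>
  have "w + ?c *\<^sub>R v = 0"
  proof (rule lorentz_orthogonal_basis[of e1 e2 n v])
    show "lorentz e1 e1 = 1" "lorentz e2 e2 = 1" "lorentz n n = 1" "lorentz v v = -1" "lorentz e1 e2 = 0"
      using e n v by simp_all
    show "lorentz e1 n = 0" "lorentz e2 n = 0" "lorentz e1 v = 0" "lorentz e2 v = 0" "lorentz n v = 0"
      using oe[OF n(2,3)] oe[OF o(1,2)] o(3) by (metis lorentz_commute)+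
    show "lorentz (w + ?c *\<^sub>R v) e1 = 0" "lorentz (w + ?c *\<^sub>R v) e2 = 0" "lorentz (w + ?c *\<^sub>R v) n = 0"
      using oe[OF o(1,2)] oe[OF o(4,5)] o(3,6) by (simp_all add: lorentz_add lorentz_scaleR)
    show "lorentz (w + ?c *\<^sub>R v) v = 0"
      unfolding lorentz_add lorentz_scaleR v lorentz_commute[of v w] by simp
  qed
  then have eq: "w = (- ?c) *\<^sub>R v" by (simp add: eq_neg_iff_add_eq_0)
  then have "lorentz w w = - ?c\<^sup>2"
    using v by (metis lorentz_scaleR minus_mult_minus mult.assoc mult_minus1_right power2_eq_square)
  then have "?c\<^sup>2 = 1" using w by simp
  then have "?c = -1" using pos by (simp add: power2_eq_1_iff)
  then show ?thesis using eq by simp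
qed

section \<open>Derivative of a tangent field at a zero\<close>

lemma has_derivative_bilinear_zero:
  assumes P: "bounded_bilinear P" and f: "f differentiable (at u)"
    and k: "(k has_derivative k') (at u)" "k u = 0"
  shows "((\<lambda>w. P (f w) (k w)) has_derivative (\<lambda>h. P (f u) (k' h))) (at u)"
proof -
  obtain f' where "(f has_derivative f') (at u)" using f unfolding differentiable_def by blast
  from bounded_bilinear.FDERIV[OF P this k(1)] show ?thesis
    using k(2) by (simp add: bounded_bilinear.zero_right[OF P])
qed

text \<open>Cramer's rule multiplied by the determinant. The coefficients are then polynomial in
  products of the fields, so along moving \<open>d1\<close>, \<open>d2\<close> and \<open>v\<close>
  both sides can be differentiated by the product rule.\<close>

lemma plane_cramer:
  assumes "v \<in> plane d1 d2"
  shows "gram d1 d2 *\<^sub>R v =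
    (lorentz d2 d2 * lorentz d1 v - lorentz d1 d2 * lorentz d2 v) *\<^sub>R d1 +
    (lorentz d1 d1 * lorentz d2 v - lorentz d1 d2 * lorentz d1 v) *\<^sub>R d2"
proof -
  obtain a b where v: "v = a *\<^sub>R d1 + b *\<^sub>R d2" using assms unfolding plane_def by blast
  have "lorentz d2 d2 * lorentz d1 v - lorentz d1 d2 * lorentz d2 v = gram d1 d2 * a"
    "lorentz d1 d1 * lorentz d2 v - lorentz d1 d2 * lorentz d1 v = gram d1 d2 * b"
    unfolding v lorentz_simps lorentz_commute[of d2 d1] gram_def by algebra+
  then show ?thesis unfolding v by (simp add: scaleR_add_right)
qed

text \<open>Differentiate Cramer's rule at a zero of \<open>K\<close>: only the terms with \<open>K'\<close> survive.\<close>

lemma derivative_tangent_field: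
  assumes d: "d1 differentiable (at u)" "d2 differentiable (at u)"
    and K: "(K has_derivative K') (at u)" "K u = 0"
    and W: "open W" "u \<in> W" "\<And>w. w \<in> W \<Longrightarrow> K w \<in> plane (d1 w) (d2 w)"
    and g: "gram (d1 u) (d2 u) \<noteq> 0"
  shows "K' h \<in> plane (d1 u) (d2 u)"
proof -
  have lorentz_diff: "(\<lambda>w. lorentz (a w) (b w)) differentiable (at u)"
    if "a differentiable (at u)" "b differentiable (at u)" for a b
    using that has_derivative_lorentz unfolding differentiable_def by blast
  have gram_diff: "(\<lambda>w. gram (d1 w) (d2 w)) differentiable (at u)"
    unfolding gram_def power2_eq_square
    using d by (intro differentiable_diff differentiable_mult lorentz_diff)
  have coeff: "((\<lambda>w. lorentz (a w) (b w) * lorentz (c w) (K w)) has_derivative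
      (\<lambda>h. lorentz (a u) (b u) * lorentz (c u) (K' h))) (at u)"
    if "a differentiable (at u)" "b differentiable (at u)" "c differentiable (at u)" for a b c
    using that K lorentz_diff
    by (intro has_derivative_bilinear_zero[OF bounded_bilinear_mult]
        has_derivative_bilinear_zero[OF bounded_bilinear_lorentz]) (auto simp: lorentz_zero)
  have term_deriv: "((\<lambda>w. (lorentz (a w) (b w) * lorentz (c w) (K w) - lorentz (a' w) (b' w) * lorentz (c' w) (K w)) *\<^sub>R e w)
      has_derivative
      (\<lambda>h. (lorentz (a u) (b u) * lorentz (c u) (K' h) - lorentz (a' u) (b' u) * lorentz (c' u) (K' h)) *\<^sub>R e u)) (at u)"
    if "a differentiable (at u)" "b differentiable (at u)" "c differentiable (at u)"
      "a' differentiable (at u)" "b' differentiable (at u)" "c' differentiable (at u)" "e differentiable (at u)"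
    for a b c a' b' c' e
    using that K(2)
    by (intro has_derivative_bilinear_zero[OF bounded_bilinear.flip[OF bounded_bilinear_scaleR]]
        has_derivative_diff coeff) (auto simp: lorentz_zero)
  have L: "((\<lambda>w. gram (d1 w) (d2 w) *\<^sub>R K w) has_derivative (\<lambda>h. gram (d1 u) (d2 u) *\<^sub>R K' h)) (at u)"
    by (rule has_derivative_bilinear_zero[OF bounded_bilinear_scaleR gram_diff K])
  have R: "((\<lambda>w. (lorentz (d2 w) (d2 w) * lorentz (d1 w) (K w) - lorentz (d1 w) (d2 w) * lorentz (d2 w) (K w)) *\<^sub>R d1 w +
      (lorentz (d1 w) (d1 w) * lorentz (d2 w) (K w) - lorentz (d1 w) (d2 w) * lorentz (d1 w) (K w)) *\<^sub>R d2 w)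
    has_derivative
    (\<lambda>h. (lorentz (d2 u) (d2 u) * lorentz (d1 u) (K' h) - lorentz (d1 u) (d2 u) * lorentz (d2 u) (K' h)) *\<^sub>R d1 u +
      (lorentz (d1 u) (d1 u) * lorentz (d2 u) (K' h) - lorentz (d1 u) (d2 u) * lorentz (d1 u) (K' h)) *\<^sub>R d2 u)) (at u)"
    using d by (intro has_derivative_add term_deriv)
  have "(\<lambda>h. gram (d1 u) (d2 u) *\<^sub>R K' h) =
    (\<lambda>h. (lorentz (d2 u) (d2 u) * lorentz (d1 u) (K' h) - lorentz (d1 u) (d2 u) * lorentz (d2 u) (K' h)) *\<^sub>R d1 u +
      (lorentz (d1 u) (d1 u) * lorentz (d2 u) (K' h) - lorentz (d1 u) (d2 u) * lorentz (d1 u) (K' h)) *\<^sub>R d2 u)"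
    using has_derivative_transform_within_open[OF L W(1,2) plane_cramer[OF W(3)]] R
    by (rule has_derivative_unique)
  then have "gram (d1 u) (d2 u) *\<^sub>R K' h \<in> plane (d1 u) (d2 u)"
    unfolding plane_def by (auto simp: fun_eq_iff)
  then obtain a b where "gram (d1 u) (d2 u) *\<^sub>R K' h = a *\<^sub>R d1 u + b *\<^sub>R d2 u"
    unfolding plane_def by blast
  then have "(1 / gram (d1 u) (d2 u)) *\<^sub>R (gram (d1 u) (d2 u) *\<^sub>R K' h) =
      (a / gram (d1 u) (d2 u)) *\<^sub>R d1 u + (b / gram (d1 u) (d2 u)) *\<^sub>R d2 u"
    by (simp add: scaleR_add_right)
  then show ?thesis using g plane_mem by simp
qed

section \<open>Space-like surfaces in a chart\<close>

abbreviation pd :: "('a \<Rightarrow> 'b::real_normed_vector) \<Rightarrow> (real^2 \<Rightarrow> 'a) \<Rightarrow> 2 \<Rightarrow> real^2 \<Rightarrow> 'b" where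
  "pd f p i u \<equiv> frechet_derivative (f \<circ> p) (at u) (axis i 1)"

text \<open>Positivity of the metric in coordinates is what the linear algebra consumes, and for the
  projection it follows by computation. The locale thus serves \<open>X\<close> and
  \<open>Xhat\<close> alike.\<close>

locale spacelike_surface =
  fixes S :: "'a topology" and A :: "'a atlas" and X :: "'a \<Rightarrow> minkowski"
  assumes surface: "smooth_surface S A"
    and smooth: "smooth_along A (topspace S) X"
    and positive: "(U, p) \<in> A \<Longrightarrow> u \<in> U \<Longrightarrow>
      0 < lorentz (pd X p 1 u) (pd X p 1 u) \<and> 0 < gram (pd X p 1 u) (pd X p 2 u)"
begin

lemma gram_nonzero: "(U, p) \<in> A \<Longrightarrow> u \<in> U \<Longrightarrow> gram (pd X p 1 u) (pd X p 2 u) \<noteq> 0"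
  using positive by fastforce

lemma differentiable_chart: "(U, p) \<in> A \<Longrightarrow> u \<in> U \<Longrightarrow> (X \<circ> p) differentiable (at u)"
  using smooth_on_differentiable smooth_along_chart[OF surface smooth] by blast

lemma derivative_chart:
  assumes "(U, p) \<in> A" "u \<in> U"
  shows "frechet_derivative (X \<circ> p) (at u) \<xi> = \<xi> $ 1 *\<^sub>R pd X p 1 u + \<xi> $ 2 *\<^sub>R pd X p 2 u"
  using linear_on_plane[OF linear_frechet_derivative[OF differentiable_chart[OF assms]]] .

lemma derivative_chart_coords:
  assumes "(U, p) \<in> A" "u \<in> U"
  shows "a *\<^sub>R pd X p 1 u + b *\<^sub>R pd X p 2 u = frechet_derivative (X \<circ> p) (at u) (vector [a, b])"
  using derivative_chart[OF assms, of "vector [a, b]"] by simp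

lemma tangent_space_eq_plane:
  assumes "(U, p) \<in> A" "u \<in> U"
  shows "tangent_space A X (p u) = plane (pd X p 1 u) (pd X p 2 u)"
proof -
  have "tangent_space A X (p u) = range (frechet_derivative (X \<circ> p) (at u))"
    by (rule tangent_space_chart[OF surface assms refl]) (rule differentiable_chart)
  also have "\<dots> = plane (pd X p 1 u) (pd X p 2 u)"
  proof
    show "range (frechet_derivative (X \<circ> p) (at u)) \<subseteq> plane (pd X p 1 u) (pd X p 2 u)"
      by (intro image_subsetI) (subst derivative_chart[OF assms], rule plane_mem)
    show "plane (pd X p 1 u) (pd X p 2 u) \<subseteq> range (frechet_derivative (X \<circ> p) (at u))"
      unfolding plane_def using derivative_chart_coords[OF assms] by auto
  qed
  finally show ?thesis .
qed

lemma inj_derivative: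
  assumes "(U, p) \<in> A" "u \<in> U"
  shows "inj (frechet_derivative (X \<circ> p) (at u))"
proof -
  have "linear (frechet_derivative (X \<circ> p) (at u))"
    using differentiable_chart[OF assms] linear_frechet_derivative by blast
  moreover have "\<xi> = 0" if "frechet_derivative (X \<circ> p) (at u) \<xi> = 0" for \<xi>
  proof -
    have "\<xi> $ 1 *\<^sub>R pd X p 1 u + \<xi> $ 2 *\<^sub>R pd X p 2 u = 0"
      using that derivative_chart[OF assms, of \<xi>] by (rule trans[OF sym, rotated])
    from plane_coeffs_zero[OF gram_nonzero[OF assms] this] show ?thesis
      by (simp add: vec_eq_iff forall_2)
  qed
  ultimately show ?thesis by (simp add: linear_injective_0)
qed

lemma surf_deriv_eq:
  assumes "(U, p) \<in> A" "u \<in> U" "(f \<circ> p) differentiable (at u)"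
  shows "surf_deriv A X f (p u) (frechet_derivative (X \<circ> p) (at u) \<xi>) = frechet_derivative (f \<circ> p) (at u) \<xi>"
  by (rule surf_deriv_chart[OF surface assms(1,2) refl _ inj_derivative[OF assms(1,2)] assms(3)])
    (rule differentiable_chart)

lemma surf_deriv_coords:
  assumes "(U, p) \<in> A" "u \<in> U" "(f \<circ> p) differentiable (at u)"
  shows "surf_deriv A X f (p u) (a *\<^sub>R pd X p 1 u + b *\<^sub>R pd X p 2 u) = a *\<^sub>R pd f p 1 u + b *\<^sub>R pd f p 2 u"
  unfolding derivative_chart_coords[OF assms(1,2)] surf_deriv_eq[OF assms]
  using linear_on_plane[OF linear_frechet_derivative[OF assms(3)], of "vector [a, b]"] by simp

lemma surf_gradient_eq:
  assumes "(U, p) \<in> A" "u \<in> U" "(f \<circ> p) differentiable (at u)"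
  shows "surf_gradient A X f (p u) = dual_vector (pd X p 1 u) (pd X p 2 u) (pd f p 1 u) (pd f p 2 u)"
    (is "_ = ?G")
  unfolding surf_gradient_def tangent_space_eq_plane[OF assms(1,2)]
proof (rule the_equality)
  note g = gram_nonzero[OF assms(1,2)]
  have deriv: "surf_deriv A X f (p u) (a *\<^sub>R pd X p 1 u + b *\<^sub>R pd X p 2 u) = a * pd f p 1 u + b * pd f p 2 u" for a b
    using surf_deriv_coords[OF assms] by simp
  have "lorentz ?G (a *\<^sub>R pd X p 1 u + b *\<^sub>R pd X p 2 u) = a * pd f p 1 u + b * pd f p 2 u" for a b
    using lorentz_dual_vector[OF g] by (simp add: lorentz_simps)
  then show "?G \<in> plane (pd X p 1 u) (pd X p 2 u) \<and>
      (\<forall>Y\<in>plane (pd X p 1 u) (pd X p 2 u). lorentz ?G Y = surf_deriv A X f (p u) Y)"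
    using deriv dual_vector_mem unfolding plane_def by auto
  fix G assume G: "G \<in> plane (pd X p 1 u) (pd X p 2 u) \<and>
      (\<forall>Y\<in>plane (pd X p 1 u) (pd X p 2 u). lorentz G Y = surf_deriv A X f (p u) Y)"
  then have "lorentz G (pd X p 1 u) = pd f p 1 u" "lorentz G (pd X p 2 u) = pd f p 2 u"
    using deriv[of 1 0] deriv[of 0 1] plane_basis by auto
  then show "G = ?G"
    using G lorentz_dual_vector[OF g] by (intro plane_eqI[OF g] dual_vector_mem) auto
qed

lemma mean_curvature_wrt_eq:
  assumes p: "(U, p) \<in> A" "u \<in> U" and n: "(n \<circ> p) differentiable (at u)"
  defines "d1 \<equiv> pd X p 1 u" and "d2 \<equiv> pd X p 2 u" and "n1 \<equiv> pd n p 1 u" and "n2 \<equiv> pd n p 2 u"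
  shows "mean_curvature_wrt A X n (p u) =
    (lorentz d2 d2 * lorentz n1 d1 - lorentz d1 d2 * (lorentz n1 d2 + lorentz n2 d1) +
      lorentz d1 d1 * lorentz n2 d2) / gram d1 d2"
proof -
  have "metric_trace (plane d1 d2) (\<lambda>Y Z. lorentz (surf_deriv A X n (p u) Y) Z) = (1 / gram d1 d2) *\<^sub>R
    (lorentz d2 d2 *\<^sub>R lorentz n1 d1 - lorentz d1 d2 *\<^sub>R (lorentz n1 d2 + lorentz n2 d1) +
      lorentz d1 d1 *\<^sub>R lorentz n2 d2)"
  proof (rule metric_trace_plane)
    show "0 < lorentz d1 d1" "0 < gram d1 d2" using positive[OF p] by (simp_all add: d1_def d2_def)
    show "lorentz (surf_deriv A X n (p u) (a *\<^sub>R d1 + b *\<^sub>R d2)) (c *\<^sub>R d1 + e *\<^sub>R d2) =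
      (a * c) *\<^sub>R lorentz n1 d1 + (a * e) *\<^sub>R lorentz n1 d2 + (b * c) *\<^sub>R lorentz n2 d1 + (b * e) *\<^sub>R lorentz n2 d2"
      for a b c e
      unfolding d1_def d2_def surf_deriv_coords[OF p n] n1_def[symmetric] n2_def[symmetric]
      by (simp add: lorentz_simps algebra_simps)
  qed
  then show ?thesis
    unfolding mean_curvature_wrt_def tangent_space_eq_plane[OF p] by (simp add: d1_def d2_def)
qed

text \<open>The field with constant coordinates \<open>\<zeta>\<close> in the chart \<open>p\<close>
  is the witness for the tangent extension in \<open>second_fundamental_form\<close>. Its smoothness
  is required in every chart \<open>q\<close>, where it is a smooth map composed with the transition
  map.\<close>

lemma coordinate_field_smooth:
  assumes p: "(U, p) \<in> A"
  shows "smooth_along A (p ` U) (\<lambda>y. frechet_derivative (X \<circ> p) (at (inv_into U p y)) \<zeta>)"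
  unfolding smooth_along_def
proof (intro ballI, clarify)
  fix V q assume q: "(V, q) \<in> A"
  note t = chart_transition[OF surface q p]
  have "smooth_on {v \<in> V. q v \<in> p ` U} (\<lambda>v. frechet_derivative (X \<circ> p) (at ((inv_into U p \<circ> q) v)) \<zeta>)"
    using t(3) by (intro smooth_on_compose[OF t(1) surface_chart(1)[OF surface p] _ t(2)]
        smooth_on_frechet_derivative smooth_along_chart[OF surface smooth p]) blast
  then show "smooth_on {v \<in> V. q v \<in> p ` U}
      ((\<lambda>y. frechet_derivative (X \<circ> p) (at (inv_into U p y)) \<zeta>) \<circ> q)"
    by (simp add: o_def)
qed

text \<open>Two tangent extensions of the same vector differ by a tangent field that vanishes at the
  point. By \<open>derivative_tangent_field\<close> its derivative there is tangent, so the normal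
  part does not see the choice; the field with constant coordinates gives the value.\<close>

lemma second_fundamental_form_eq:
  assumes p: "(U, p) \<in> A" and u: "u \<in> U"
  shows "second_fundamental_form S A X (p u) (frechet_derivative (X \<circ> p) (at u) \<xi>)
      (frechet_derivative (X \<circ> p) (at u) \<zeta>) =
    normal_part (plane (pd X p 1 u) (pd X p 2 u))
      (frechet_derivative (\<lambda>w. frechet_derivative (X \<circ> p) (at w) \<zeta>) (at u) \<xi>)"
  unfolding second_fundamental_form_def tangent_space_eq_plane[OF p u]
proof (rule the_equality)
  let ?P = "\<lambda>w. plane (pd X p 1 w) (pd X p 2 w)"
  let ?E = "\<lambda>w. frechet_derivative (X \<circ> p) (at w) \<zeta>"
  note U = surface_chart(1)[OF surface p] and g = gram_nonzero[OF p u]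
  have smooth_pd: "smooth_on U (\<lambda>w. frechet_derivative (X \<circ> p) (at w) \<eta>)" for \<eta>
    by (rule smooth_on_frechet_derivative[OF smooth_along_chart[OF surface smooth p]])
  have dE: "?E differentiable (at u)"
    by (rule smooth_on_differentiable[OF smooth_pd u])
  have inv: "inv_into U p (p w) = w" if "w \<in> U" for w
    using surface_chart(3)[OF surface p] that by simp
  let ?F = "\<lambda>y. ?E (inv_into U p y)"
  have FE: "(?F \<circ> p) w = ?E w" if "w \<in> U" for w
    using inv[OF that] by simp
  have "(?F \<circ> p has_derivative frechet_derivative ?E (at u)) (at u)"
    using dE[unfolded frechet_derivative_works] U u
    by (rule has_derivative_transform_within_open) (rule FE[symmetric])
  then have dF: "(?F \<circ> p) differentiable (at u)"
      "frechet_derivative (?F \<circ> p) (at u) = frechet_derivative ?E (at u)"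
    by (rule differentiableI, rule frechet_derivative_at[symmetric])
  show "\<exists>W F. openin S W \<and> p u \<in> W \<and> smooth_along A W F \<and>
      (\<forall>y\<in>W. F y \<in> tangent_space A X y) \<and> F (p u) = ?E u \<and>
      normal_part (?P u) (frechet_derivative ?E (at u) \<xi>) =
        normal_part (?P u) (surf_deriv A X F (p u) (frechet_derivative (X \<circ> p) (at u) \<xi>))"
  proof (intro exI conjI)
    show "openin S (p ` U)" by (rule surface_chart(2)[OF surface p])
    show "smooth_along A (p ` U) ?F" by (rule coordinate_field_smooth[OF p])
    show "\<forall>y\<in>p ` U. ?F y \<in> tangent_space A X y"
    proof clarify
      fix w assume w: "w \<in> U"
      have "?E w \<in> tangent_space A X (p w)" using p w unfolding tangent_space_def by blast
      then show "?F (p w) \<in> tangent_space A X (p w)" using inv[OF w] by simp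
    qed
    show "normal_part (?P u) (frechet_derivative ?E (at u) \<xi>) =
        normal_part (?P u) (surf_deriv A X ?F (p u) (frechet_derivative (X \<circ> p) (at u) \<xi>))"
      unfolding surf_deriv_eq[OF p u dF(1)] dF(2) ..
  qed (use u inv in auto)
next
  let ?P = "\<lambda>w. plane (pd X p 1 w) (pd X p 2 w)"
  let ?E = "\<lambda>w. frechet_derivative (X \<circ> p) (at w) \<zeta>"
  note U = surface_chart(1)[OF surface p] and g = gram_nonzero[OF p u]
  have pd_diff: "(\<lambda>w. frechet_derivative (X \<circ> p) (at w) \<eta>) differentiable (at u)" for \<eta>
    using smooth_on_differentiable[OF smooth_on_frechet_derivative[OF smooth_along_chart[OF surface smooth p]] u] .
  fix n assume "\<exists>W F. openin S W \<and> p u \<in> W \<and> smooth_along A W F \<and>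
      (\<forall>y\<in>W. F y \<in> tangent_space A X y) \<and> F (p u) = ?E u \<and>
      n = normal_part (?P u) (surf_deriv A X F (p u) (frechet_derivative (X \<circ> p) (at u) \<xi>))"
  then obtain W F where W: "openin S W" "p u \<in> W" and F: "smooth_along A W F"
    "\<And>y. y \<in> W \<Longrightarrow> F y \<in> tangent_space A X y" "F (p u) = ?E u"
    and n: "n = normal_part (?P u) (surf_deriv A X F (p u) (frechet_derivative (X \<circ> p) (at u) \<xi>))"
    by blast
  define O' where "O' = {w \<in> U. p w \<in> W}"
  have O': "open O'" "u \<in> O'"
    using surface_chart(5)[OF surface p W(1)] u W(2) by (auto simp: O'_def)
  have "smooth_on O' (F \<circ> p)" using F(1) p unfolding smooth_along_def O'_def by blast
  then have dF: "(F \<circ> p) differentiable (at u)" by (rule smooth_on_differentiable[OF _ O'(2)])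
  let ?K = "\<lambda>w. (F \<circ> p) w - ?E w"
  let ?K' = "\<lambda>h. frechet_derivative (F \<circ> p) (at u) h - frechet_derivative ?E (at u) h"
  have "?K' \<xi> \<in> ?P u"
  proof (rule derivative_tangent_field[OF pd_diff pd_diff _ _ O' _ g])
    show "(?K has_derivative ?K') (at u)"
      by (intro has_derivative_diff dF[unfolded frechet_derivative_works] pd_diff[unfolded frechet_derivative_works])
    show "?K u = 0" using F(3) by simp
    show "?K w \<in> ?P w" if "w \<in> O'" for w
    proof (rule plane_diff)
      have w: "w \<in> U" "p w \<in> W" using that by (auto simp: O'_def)
      show "(F \<circ> p) w \<in> ?P w" using F(2)[OF w(2)] tangent_space_eq_plane[OF p w(1)] by simp
      show "?E w \<in> ?P w" by (subst derivative_chart[OF p w(1)], rule plane_mem)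
    qed
  qed
  then have "normal_part (?P u) (?K' \<xi>) = 0" by (rule normal_part_tangent[OF g])
  moreover have "frechet_derivative (F \<circ> p) (at u) \<xi> = frechet_derivative ?E (at u) \<xi> + ?K' \<xi>" by simp
  ultimately show "n = normal_part (?P u) (frechet_derivative ?E (at u) \<xi>)"
    unfolding n surf_deriv_eq[OF p u dF] using normal_part_linear(1)[OF g] by (metis add.right_neutral)
qed

text \<open>The sign comes from differentiating the orthogonality of \<open>n\<close> and the
  coordinate vectors: a derivative of a coordinate vector, paired with \<open>n\<close>, is minus
  the corresponding derivative of \<open>n\<close> paired with the vector. Passing to the normal
  part does not affect products with \<open>n\<close>.\<close>

lemma mean_curvature_vector_normal:
  assumes p: "(U, p) \<in> A" "u \<in> U" and n: "\<And>w. w \<in> U \<Longrightarrow> (n \<circ> p) differentiable (at w)"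
    and orth: "\<And>w i. w \<in> U \<Longrightarrow> lorentz (n (p w)) (pd X p i w) = 0"
  defines "d1 \<equiv> pd X p 1 u" and "d2 \<equiv> pd X p 2 u" and "n1 \<equiv> pd n p 1 u" and "n2 \<equiv> pd n p 2 u"
  shows "lorentz (mean_curvature_vector S A X (p u)) (n (p u)) =
    - (lorentz d2 d2 * lorentz n1 d1 - lorentz d1 d2 * (lorentz n1 d2 + lorentz n2 d1) +
      lorentz d1 d1 * lorentz n2 d2) / gram d1 d2"
proof -
  note g = gram_nonzero[OF p, folded d1_def d2_def]
  have pd_diff: "(\<lambda>w. frechet_derivative (X \<circ> p) (at w) \<eta>) differentiable (at u)" for \<eta>
    using smooth_on_differentiable[OF smooth_on_frechet_derivative[OF smooth_along_chart[OF surface smooth p(1)]] p(2)] .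
  define D where "D i j = frechet_derivative (pd X p j) (at u) (axis i 1)" for i j
  let ?B = "\<lambda>i j. normal_part (plane d1 d2) (D i j)"
  have second: "frechet_derivative (\<lambda>w. frechet_derivative (X \<circ> p) (at w) (vector [c, e])) (at u) (vector [a, b]) =
      (a * c) *\<^sub>R D 1 1 + (a * e) *\<^sub>R D 1 2 + (b * c) *\<^sub>R D 2 1 + (b * e) *\<^sub>R D 2 2" for a b c e
  proof -
    let ?V = "\<lambda>w. frechet_derivative (X \<circ> p) (at w) (vector [c, e])"
    let ?L = "\<lambda>h. c *\<^sub>R frechet_derivative (pd X p 1) (at u) h + e *\<^sub>R frechet_derivative (pd X p 2) (at u) h"
    have "((\<lambda>w. c *\<^sub>R pd X p 1 w + e *\<^sub>R pd X p 2 w) has_derivative ?L) (at u)"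
      by (intro has_derivative_add has_derivative_scaleR_right pd_diff[unfolded frechet_derivative_works])
    then have "(?V has_derivative ?L) (at u)"
      using surface_chart(1)[OF surface p(1)] p(2)
      by (rule has_derivative_transform_within_open) (rule derivative_chart_coords[OF p(1)])
    then have "frechet_derivative ?V (at u) = ?L" by (rule frechet_derivative_at[symmetric])
    moreover have "frechet_derivative (pd X p i) (at u) (vector [a, b]) = a *\<^sub>R D 1 i + b *\<^sub>R D 2 i" for i
      using linear_on_plane[OF linear_frechet_derivative[OF pd_diff[of "axis i 1"]], of "vector [a, b]"]
      by (simp add: D_def)
    ultimately show ?thesis by (simp add: algebra_simps)
  qed
  have "mean_curvature_vector S A X (p u) = (1 / gram d1 d2) *\<^sub>R
    (lorentz d2 d2 *\<^sub>R ?B 1 1 - lorentz d1 d2 *\<^sub>R (?B 1 2 + ?B 2 1) + lorentz d1 d1 *\<^sub>R ?B 2 2)"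
    unfolding mean_curvature_vector_def tangent_space_eq_plane[OF p] d1_def[symmetric] d2_def[symmetric]
  proof (rule metric_trace_plane)
    show "0 < lorentz d1 d1" "0 < gram d1 d2" using positive[OF p] by (simp_all add: d1_def d2_def)
    show "second_fundamental_form S A X (p u) (a *\<^sub>R d1 + b *\<^sub>R d2) (c *\<^sub>R d1 + e *\<^sub>R d2) =
      (a * c) *\<^sub>R ?B 1 1 + (a * e) *\<^sub>R ?B 1 2 + (b * c) *\<^sub>R ?B 2 1 + (b * e) *\<^sub>R ?B 2 2" for a b c e
      unfolding d1_def d2_def derivative_chart_coords[OF p] second_fundamental_form_eq[OF p] second
      unfolding d1_def[symmetric] d2_def[symmetric] normal_part_linear[OF g] ..
  qed
  moreover have "lorentz (?B i j) (n (p u)) = - lorentz (pd n p i u) (pd X p j u)" for i j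
  proof -
    have dn: "((n \<circ> p) has_derivative frechet_derivative (n \<circ> p) (at u)) (at u)"
      using n[OF p(2)] by (simp add: frechet_derivative_works[symmetric])
    have "((\<lambda>w. lorentz ((n \<circ> p) w) (pd X p j w)) has_derivative
      (\<lambda>h. lorentz ((n \<circ> p) u) (frechet_derivative (pd X p j) (at u) h) +
        lorentz (frechet_derivative (n \<circ> p) (at u) h) (pd X p j u))) (at u)" (is "(_ has_derivative ?f) _")
      by (rule has_derivative_lorentz[OF dn pd_diff[unfolded frechet_derivative_works]])
    \<comment> \<open>On \<open>U\<close> the differentiated product is constantly 0 by
      orthogonality, so its derivative \<open>?f\<close> must vanish.\<close>
    then have "((\<lambda>w. 0) has_derivative ?f) (at u)"
      by (rule has_derivative_transform_within_open[OF _ surface_chart(1)[OF surface p(1)] p(2)])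
        (simp add: orth)
    then have "?f = (\<lambda>h. 0)"
      by (rule has_derivative_unique) (rule has_derivative_const)
    then have "?f (axis i 1) = 0" by metis
    then have "lorentz (D i j) (n (p u)) = - lorentz (pd n p i u) (pd X p j u)"
      unfolding D_def by (simp add: lorentz_commute[of "n (p u)"])
    then show ?thesis
      using lorentz_normal_part[OF g, of "n (p u)"] orth[OF p(2)] by (simp add: d1_def d2_def)
  qed
  ultimately show ?thesis
    by (simp add: lorentz_simps d1_def[symmetric] d2_def[symmetric] n1_def[symmetric] n2_def[symmetric])
      (simp add: algebra_simps divide_inverse)
qed

end

section \<open>Projection along a time-like direction\<close>

text \<open>The algebra of a rank-one change of a 2 by 2 matrix: \<open>x\<close>, \<open>y\<close>,
  \<open>z\<close> are the entries of the metric, \<open>a\<close>, \<open>b\<close> the coordinates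
  of the gradient, and \<open>h\<close> is the sum of the two mixed entries of the second
  fundamental form. The first claim is the matrix determinant lemma; the second contracts the
  Sherman-Morrison inverse with the second fundamental form and multiplies by
  \<open>R\<close>.\<close>

lemma projected_curvature_identity:
  fixes x y z t1 t2 h11 h h22 R :: real
  assumes D: "0 < x * z - y\<^sup>2" (is "0 < ?D") and R: "0 < R"
    and a: "a = (z * t1 - y * t2) / (x * z - y\<^sup>2)" and b: "b = (x * t2 - y * t1) / (x * z - y\<^sup>2)"
    and R2: "R\<^sup>2 = 1 + (a * t1 + b * t2)"
  shows "(x + t1\<^sup>2) * (z + t2\<^sup>2) - (y + t1 * t2)\<^sup>2 = R\<^sup>2 * (x * z - y\<^sup>2)"
    "((z + t2\<^sup>2) * h11 - (y + t1 * t2) * h + (x + t1\<^sup>2) * h22) /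
        ((x + t1\<^sup>2) * (z + t2\<^sup>2) - (y + t1 * t2)\<^sup>2) * R =
      ((z * h11 - y * h + x * h22) / (x * z - y\<^sup>2)) * R - (a\<^sup>2 * h11 + a * b * h + b\<^sup>2 * h22) / R"
proof -
  have Da: "?D * a = z * t1 - y * t2" "?D * b = x * t2 - y * t1" using D a b by simp_all
  have "?D * R\<^sup>2 = ?D + (?D * a) * t1 + (?D * b) * t2" unfolding R2 by algebra
  then show Dh: "(x + t1\<^sup>2) * (z + t2\<^sup>2) - (y + t1 * t2)\<^sup>2 = R\<^sup>2 * ?D"
    unfolding Da by algebra
  let ?K = "(z + t2\<^sup>2) * h11 - (y + t1 * t2) * h + (x + t1\<^sup>2) * h22"
  let ?M = "z * h11 - y * h + x * h22" and ?Q = "a\<^sup>2 * h11 + a * b * h + b\<^sup>2 * h22"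
  \<comment> \<open>Sherman-Morrison with all denominators cleared, so that it becomes a polynomial
    identity.\<close>
  have "?D * ?K = ?M * ((x + t1\<^sup>2) * (z + t2\<^sup>2) - (y + t1 * t2)\<^sup>2) -
      ((z * t1 - y * t2)\<^sup>2 * h11 + (z * t1 - y * t2) * (x * t2 - y * t1) * h + (x * t2 - y * t1)\<^sup>2 * h22)"
    by algebra
  also have "\<dots> = ?D * (?M * R\<^sup>2 - ?D * ?Q)"
    unfolding Dh Da[symmetric] by algebra
  finally have "?K = ?M * R\<^sup>2 - ?D * ?Q" using D by simp
  moreover have "(m * R\<^sup>2 - d * q) / (R\<^sup>2 * d) * R = (m / d) * R - q / R" if "0 < d" for m d q
    using that R by (simp add: field_simps power2_eq_square)
  ultimately show "?K / ((x + t1\<^sup>2) * (z + t2\<^sup>2) - (y + t1 * t2)\<^sup>2) * R = (?M / ?D) * R - ?Q / R"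
    unfolding Dh using D by simp
qed

text \<open>Reads off the time orientation from a product with a known future vector. If
  \<open>v\<close> pointed to the past, \<open>- v\<close> would point to the future, and its
  product with \<open>T\<close> would have to be negative too.\<close>

lemma future_timelike_sign:
  assumes v: "lorentz v v = -1" and T: "lorentz T T = -1" "fst T > 0" and neg: "lorentz v T < 0"
  shows "fst v > 0"
proof (rule ccontr)
  assume "\<not> fst v > 0"
  moreover have "fst v \<noteq> 0"
  proof
    assume "fst v = 0"
    then have "lorentz v v = (norm (snd v))\<^sup>2" by (simp add: lorentz_def dot_square_norm)
    then show False using v by (metis neg_0_le_iff_le not_one_le_zero zero_le_power2)
  qed
  ultimately have "fst (- v) > 0" by simp
  moreover have "lorentz (- v) (- v) = -1" using v by (simp add: lorentz_def)
  ultimately have "lorentz (- v) T < 0" using future_timelike_lorentz_neg T by blast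
  moreover have "lorentz (- v) T = - lorentz v T" by (simp add: lorentz_def)
  ultimately show False using neg by simp
qed

text \<open>In this locale \<open>n\<close> is the field \<open>e3\<close> of the theorem.\<close>

locale projected_surface = spacelike_surface S A X
  for S :: "'a topology" and A :: "'a atlas" and X :: "'a \<Rightarrow> minkowski" +
  fixes T0 :: minkowski and \<tau> :: "'a \<Rightarrow> real" and Xhat n e4 :: "'a \<Rightarrow> minkowski"
  assumes T0: "future_unit_timelike T0"
    and tau: "\<tau> = (\<lambda>x. - lorentz (X x) T0)"
    and Xhat: "Xhat = (\<lambda>x. X x - \<tau> x *\<^sub>R T0)"
    and smooth_Xhat: "smooth_along A (topspace S) Xhat"
    and n_differentiable: "(U, p) \<in> A \<Longrightarrow> u \<in> U \<Longrightarrow> (n \<circ> p) differentiable (at u)"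
    and n_unit: "x \<in> topspace S \<Longrightarrow> lorentz (n x) (n x) = 1"
    and n_T0: "x \<in> topspace S \<Longrightarrow> lorentz (n x) T0 = 0"
    and n_normal: "(U, p) \<in> A \<Longrightarrow> u \<in> U \<Longrightarrow> lorentz (n (p u)) (pd Xhat p i u) = 0"
    and e4: "unit_normal_e4 S A X n e4"
begin

section \<open>First order data of the projection\<close>

lemma tau_derivative:
  assumes "(U, p) \<in> A" "u \<in> U"
  shows "((\<tau> \<circ> p) has_derivative (\<lambda>h. - lorentz (frechet_derivative (X \<circ> p) (at u) h) T0)) (at u)"
proof -
  have "bounded_linear (\<lambda>v. - lorentz v T0)"
    by (intro bounded_linear_minus bounded_bilinear.bounded_linear_left[OF bounded_bilinear_lorentz])
  from bounded_linear.has_derivative[OF this differentiable_chart[OF assms, unfolded frechet_derivative_works]]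
  show ?thesis by (simp add: tau o_def)
qed

lemma pd_tau:
  assumes "(U, p) \<in> A" "u \<in> U"
  shows "pd \<tau> p i u = - lorentz (pd X p i u) T0"
  by (rule fun_cong[OF frechet_derivative_at[OF tau_derivative[OF assms]], symmetric])

lemma pd_Xhat:
  assumes "(U, p) \<in> A" "u \<in> U"
  shows "pd Xhat p i u = pd X p i u - pd \<tau> p i u *\<^sub>R T0"
proof -
  have "((\<lambda>w. (X \<circ> p) w - (\<tau> \<circ> p) w *\<^sub>R T0) has_derivative
    (\<lambda>h. frechet_derivative (X \<circ> p) (at u) h - (- lorentz (frechet_derivative (X \<circ> p) (at u) h) T0) *\<^sub>R T0)) (at u)"
    by (intro has_derivative_diff has_derivative_scaleR_left tau_derivative[OF assms]
        differentiable_chart[OF assms, unfolded frechet_derivative_works])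
  then have "((Xhat \<circ> p) has_derivative
    (\<lambda>h. frechet_derivative (X \<circ> p) (at u) h - (- lorentz (frechet_derivative (X \<circ> p) (at u) h) T0) *\<^sub>R T0)) (at u)"
    by (simp add: Xhat o_def)
  from frechet_derivative_at[OF this, THEN fun_cong, symmetric] show ?thesis
    unfolding pd_tau[OF assms] .
qed

lemma T0_unit: "lorentz T0 T0 = -1" "fst T0 > 0"
  using T0 unfolding future_unit_timelike_def by auto

text \<open>Each of the two cross terms contributes the product of the derivatives of
  \<open>\<tau>\<close>, and the square of \<open>T0\<close> takes one of them back.\<close>

lemma lorentz_pd_Xhat:
  assumes "(U, p) \<in> A" "u \<in> U"
  shows "lorentz (pd Xhat p i u) (pd Xhat p j u) =
    lorentz (pd X p i u) (pd X p j u) + pd \<tau> p i u * pd \<tau> p j u"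
proof -
  have "lorentz (pd X p k u) T0 = - pd \<tau> p k u" "lorentz T0 (pd X p k u) = - pd \<tau> p k u" for k
    using pd_tau[OF assms] by (simp_all add: lorentz_commute[of T0])
  then show ?thesis
    unfolding pd_Xhat[OF assms] lorentz_simps T0_unit(1) by (simp add: algebra_simps)
qed

text \<open>Tangent vectors of the two surfaces differ by multiples of \<open>T0\<close>, to which
  \<open>n\<close> is orthogonal; so the same field is normal to both surfaces.\<close>

lemma n_orthogonal:
  assumes "(U, p) \<in> A" "u \<in> U"
  shows "lorentz (n (p u)) (pd X p i u) = 0"
  using n_normal[OF assms, of i] n_T0[OF surface_chart(4)[OF surface assms]]
  by (simp add: pd_Xhat[OF assms] lorentz_simps)

text \<open>\<open>T0\<close> is constant, so the orthogonality can be differentiated. This makes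
  the derivatives of \<open>n\<close> blind to the difference between the two tangent
  frames.\<close>

lemma pd_n_T0:
  assumes "(U, p) \<in> A" "u \<in> U"
  shows "lorentz (pd n p i u) T0 = 0"
proof -
  have "((\<lambda>w. lorentz ((n \<circ> p) w) T0) has_derivative (\<lambda>h. lorentz (frechet_derivative (n \<circ> p) (at u) h) T0)) (at u)"
    by (intro bounded_linear.has_derivative[OF bounded_bilinear.bounded_linear_left[OF bounded_bilinear_lorentz]]
        n_differentiable[OF assms, unfolded frechet_derivative_works])
  then have "((\<lambda>w. 0) has_derivative (\<lambda>h. lorentz (frechet_derivative (n \<circ> p) (at u) h) T0)) (at u)"
    by (rule has_derivative_transform_within_open[OF _ surface_chart(1)[OF surface assms(1)] assms(2)])
      (simp add: n_T0 surface_chart(4)[OF surface assms(1)])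
  then have "(\<lambda>h. lorentz (frechet_derivative (n \<circ> p) (at u) h) T0) = (\<lambda>h. 0)"
    by (rule has_derivative_unique) (rule has_derivative_const)
  then show ?thesis by (rule fun_cong)
qed

abbreviation stretch :: "'a \<Rightarrow> real" where
  "stretch x \<equiv> sqrt (1 + lorentz (surf_gradient A X \<tau> x) (surf_gradient A X \<tau> x))"

lemma gradient_chart:
  assumes p: "(U, p) \<in> A" "u \<in> U"
  defines "d1 \<equiv> pd X p 1 u" and "d2 \<equiv> pd X p 2 u" and "t1 \<equiv> pd \<tau> p 1 u" and "t2 \<equiv> pd \<tau> p 2 u"
    and "G \<equiv> surf_gradient A X \<tau> (p u)"
  defines "a \<equiv> (lorentz d2 d2 * t1 - lorentz d1 d2 * t2) / gram d1 d2"
    and "b \<equiv> (lorentz d1 d1 * t2 - lorentz d1 d2 * t1) / gram d1 d2"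
  shows "G = a *\<^sub>R d1 + b *\<^sub>R d2" "lorentz G d1 = t1" "lorentz G d2 = t2"
    "(stretch (p u))\<^sup>2 = 1 + (a * t1 + b * t2)" "0 < stretch (p u)" "lorentz G G = a * t1 + b * t2"
proof -
  have "(\<tau> \<circ> p) differentiable (at u)" using tau_derivative[OF p] by (rule differentiableI)
  from surf_gradient_eq[OF p this] have G: "G = dual_vector d1 d2 t1 t2"
    by (simp add: G_def d1_def d2_def t1_def t2_def)
  then show coords: "G = a *\<^sub>R d1 + b *\<^sub>R d2" by (simp add: dual_vector_def a_def b_def)
  show products: "lorentz G d1 = t1" "lorentz G d2 = t2"
    unfolding G by (rule lorentz_dual_vector, use gram_nonzero[OF p] in \<open>simp add: d1_def d2_def\<close>)+
  have "lorentz G (a *\<^sub>R d1 + b *\<^sub>R d2) = a * t1 + b * t2"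
    by (simp add: lorentz_simps products)
  then show norm: "lorentz G G = a * t1 + b * t2" using coords by simp
  have "0 \<le> lorentz G G"
  proof (cases "t1 = 0 \<and> t2 = 0")
    case True
    then show ?thesis using norm by simp
  next
    case False
    have pos: "0 < lorentz d1 d1" "0 < gram d1 d2" using positive[OF p] by (simp_all add: d1_def d2_def)
    \<comment> \<open>Completing the square: the squared length of the gradient, times two positive
      factors, becomes a sum of nonnegative terms.\<close>
    have "lorentz d1 d1 * (gram d1 d2 * (a * t1 + b * t2)) =
        gram d1 d2 * t1\<^sup>2 + (lorentz d1 d1 * t2 - lorentz d1 d2 * t1)\<^sup>2"
    proof -
      have "gram d1 d2 * a = lorentz d2 d2 * t1 - lorentz d1 d2 * t2"
        "gram d1 d2 * b = lorentz d1 d1 * t2 - lorentz d1 d2 * t1"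
        using pos(2) by (simp_all add: a_def b_def)
      then have "gram d1 d2 * (a * t1 + b * t2) =
          (lorentz d2 d2 * t1 - lorentz d1 d2 * t2) * t1 + (lorentz d1 d1 * t2 - lorentz d1 d2 * t1) * t2"
        by algebra
      then show ?thesis using gram_def[of d1 d2] by algebra
    qed
    then have "0 \<le> lorentz d1 d1 * (gram d1 d2 * (a * t1 + b * t2))" using pos by simp
    then show ?thesis using pos norm by (simp add: zero_le_mult_iff)
  qed
  then show "(stretch (p u))\<^sup>2 = 1 + (a * t1 + b * t2)" "0 < stretch (p u)"
    using norm by (simp_all add: G_def)
qed

lemma area_density_projected:
  assumes p: "(U, p) \<in> A" "u \<in> U"
  shows "area_density Xhat p u = stretch (p u) * area_density X p u" "0 < area_density X p u"
    "0 < lorentz (pd Xhat p 1 u) (pd Xhat p 1 u) \<and> 0 < gram (pd Xhat p 1 u) (pd Xhat p 2 u)"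
proof -
  note pos = positive[OF p]
  have "0 < stretch (p u)" by (rule gradient_chart(5)[OF p])
  have D: "gram (pd Xhat p 1 u) (pd Xhat p 2 u) = (stretch (p u))\<^sup>2 * gram (pd X p 1 u) (pd X p 2 u)"
    using projected_curvature_identity(1)[OF _ gradient_chart(5)[OF p] refl refl
        gradient_chart(4)[OF p, unfolded gram_def]] pos
    unfolding gram_def lorentz_pd_Xhat[OF p] by (simp add: power2_eq_square)
  show "0 < lorentz (pd Xhat p 1 u) (pd Xhat p 1 u) \<and> 0 < gram (pd Xhat p 1 u) (pd Xhat p 2 u)"
    unfolding D using pos \<open>0 < stretch (p u)\<close>
    by (simp add: lorentz_pd_Xhat[OF p] add_pos_nonneg)
  have dens: "area_density Y p u = sqrt (gram (pd Y p 1 u) (pd Y p 2 u))" for Y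
    by (simp add: area_density_def gram_def Let_def)
  show "area_density Xhat p u = stretch (p u) * area_density X p u"
    unfolding dens D real_sqrt_mult using \<open>0 < stretch (p u)\<close> by simp
  show "0 < area_density X p u"
    unfolding dens using pos by simp
qed

lemma spacelike_surface_Xhat: "spacelike_surface S A Xhat"
  by unfold_locales (use surface smooth_Xhat area_density_projected(3) in auto)

lemma stretch_pos:
  assumes "x \<in> topspace S"
  shows "0 < stretch x"
  using surface_covered[OF surface assms] gradient_chart(5) by metis

text \<open>The right-hand side satisfies every condition that determines \<open>e4\<close>: it is
  normal to the tangent plane and to \<open>n\<close>, it is a unit vector because the product of
  the gradient with \<open>T0\<close> is minus the squared length of the gradient, and it points to
  the future. The claim then follows by \<open>future_timelike_unique\<close>.\<close>

lemma e4_eq: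
  assumes x: "x \<in> topspace S"
  shows "e4 x = (1 / stretch x) *\<^sub>R (T0 + surf_gradient A X \<tau> x)"
proof -
  obtain U p u where p: "(U, p) \<in> A" "u \<in> U" and xu: "p u = x"
    using surface_covered[OF surface x] .
  define d1 d2 t1 t2 G r where d: "d1 = pd X p 1 u" "d2 = pd X p 2 u" "t1 = pd \<tau> p 1 u" "t2 = pd \<tau> p 2 u"
    "G = surf_gradient A X \<tau> x" "r = stretch x"
  define a b where ab: "a = (lorentz d2 d2 * t1 - lorentz d1 d2 * t2) / gram d1 d2"
    "b = (lorentz d1 d1 * t2 - lorentz d1 d2 * t1) / gram d1 d2"
  note grad = gradient_chart[OF p, unfolded xu, folded d, folded ab]
  have pos: "0 < lorentz d1 d1" "0 < gram d1 d2" using positive[OF p] by (simp_all add: d)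
  have r: "0 < r" "r * r = 1 + lorentz G G"
    using grad(4-6) by (simp_all add: power2_eq_square)
  have T: "lorentz T0 d1 = - lorentz G d1" "lorentz T0 d2 = - lorentz G d2"
    using grad(2,3) pd_tau[OF p] by (simp_all add: d lorentz_commute[of T0])
  have "lorentz (a *\<^sub>R d1 + b *\<^sub>R d2) T0 = - (a * t1 + b * t2)"
    using pd_tau[OF p] unfolding lorentz_add lorentz_scaleR by (simp add: d)
  then have GT: "lorentz G T0 = - lorentz G G"
    unfolding grad(1)[symmetric] grad(6) .
  have n: "lorentz (n x) d1 = 0" "lorentz (n x) d2 = 0" "lorentz (n x) T0 = 0"
    using n_orthogonal[OF p] n_T0[OF x] by (simp_all add: d xu)
  have nG: "lorentz (n x) G = 0" unfolding grad(1) using n by (simp add: lorentz_simps)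
  let ?v = "(1 / r) *\<^sub>R (T0 + G)"
  have vv: "lorentz ?v ?v = -1"
  proof -
    have "lorentz (T0 + G) (T0 + G) = - (r * r)"
      using GT T0_unit(1) r(2) by (simp add: lorentz_simps lorentz_commute[of T0 G])
    then show ?thesis using r(1) by (simp add: lorentz_scaleR)
  qed
  \<comment> \<open>The time component of \<open>?v\<close> is not directly visible; its sign is
    read from the product with \<open>T0\<close>, which is \<open>- r\<close> after
    normalization.\<close>
  have "lorentz (T0 + G) T0 = - (r * r)"
    using GT T0_unit(1) r(2) by (simp add: lorentz_simps)
  then have "lorentz ?v T0 < 0" using r(1) by (simp add: lorentz_scaleR)
  then have v_future: "fst ?v > 0" using future_timelike_sign[OF vv T0_unit] by blast
  have e4x: "lorentz (e4 x) (e4 x) = -1" "fst (e4 x) > 0" "lorentz (e4 x) (n x) = 0"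
      "lorentz (e4 x) d1 = 0" "lorentz (e4 x) d2 = 0"
    using e4 x tangent_space_eq_plane[OF p] plane_basis(1)[of d1 d2] plane_basis(2)[of d2 d1]
    unfolding unit_normal_e4_def future_unit_timelike_def by (auto simp: xu d)
  obtain e1 e2 where frame: "orthonormal_frame (plane d1 d2) e1 e2"
    using orthonormal_frame_exists[OF pos] .
  have "e4 x = ?v"
  proof (rule future_timelike_unique[OF vv e4x(1) _ _ _ _ e4x(4,5,3) n_unit[OF x] n(1,2) frame])
    show "lorentz ?v (e4 x) < 0" by (rule future_timelike_lorentz_neg[OF vv v_future e4x(1,2)])
    show "lorentz ?v d1 = 0" "lorentz ?v d2 = 0" "lorentz ?v (n x) = 0"
      using T n(3) nG by (simp_all add: lorentz_simps lorentz_commute[of _ "n x"])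
  qed
  then show ?thesis by (simp add: d)
qed

text \<open>The factor \<open>stretch x\<close> on the left is the ratio of the area elements, so
  this is the equality of integrands once both integrals are taken over the area measure of
  \<open>X\<close>.\<close>

lemma mean_curvature_projected:
  assumes x: "x \<in> topspace S"
  shows "stretch x * mean_curvature_wrt A Xhat n x =
    - lorentz (mean_curvature_vector S A X x) (n x) * stretch x
    - connection_form A X n e4 x (surf_gradient A X \<tau> x)"
proof -
  obtain U p u where p: "(U, p) \<in> A" "u \<in> U" and xu: "p u = x"
    using surface_covered[OF surface x] .
  interpret hat: spacelike_surface S A Xhat by (rule spacelike_surface_Xhat)
  define d1 d2 n1 n2 t1 t2 where d: "d1 = pd X p 1 u" "d2 = pd X p 2 u" "n1 = pd n p 1 u" "n2 = pd n p 2 u"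
    "t1 = pd \<tau> p 1 u" "t2 = pd \<tau> p 2 u"
  define G r where Gr: "G = surf_gradient A X \<tau> x" "r = stretch x"
  define a b where ab: "a = (lorentz d2 d2 * t1 - lorentz d1 d2 * t2) / gram d1 d2"
    "b = (lorentz d1 d1 * t2 - lorentz d1 d2 * t1) / gram d1 d2"
  note grad = gradient_chart[OF p, unfolded xu, folded d Gr, folded ab]
  have pos: "0 < gram d1 d2" using positive[OF p] by (simp add: d)
  have nT: "lorentz n1 T0 = 0" "lorentz n2 T0 = 0" using pd_n_T0[OF p] by (simp_all add: d)
  let ?h = "lorentz n1 d2 + lorentz n2 d1"
  let ?M = "lorentz d2 d2 * lorentz n1 d1 - lorentz d1 d2 * ?h + lorentz d1 d1 * lorentz n2 d2"
  \<comment> \<open>This is the equality of the two second fundamental forms: the tangent vectors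
    change by multiples of \<open>T0\<close>, which the derivatives of \<open>n\<close> do not
    see.\<close>
  have hat_products: "lorentz (pd n p i u) (pd Xhat p j u) = lorentz (pd n p i u) (pd X p j u)" for i j
    using pd_n_T0[OF p, of i] by (simp add: pd_Xhat[OF p] lorentz_simps)
  have H: "lorentz (mean_curvature_vector S A X x) (n x) =
    - ?M / gram d1 d2"
    using mean_curvature_vector_normal[OF p n_differentiable[OF p(1)] n_orthogonal[OF p(1)]]
    by (simp add: xu d)
  have k: "mean_curvature_wrt A Xhat n x =
    ((lorentz d2 d2 + t2\<^sup>2) * lorentz n1 d1 - (lorentz d1 d2 + t1 * t2) * ?h + (lorentz d1 d1 + t1\<^sup>2) * lorentz n2 d2) /
    ((lorentz d1 d1 + t1\<^sup>2) * (lorentz d2 d2 + t2\<^sup>2) - (lorentz d1 d2 + t1 * t2)\<^sup>2)"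
    using hat.mean_curvature_wrt_eq[OF p n_differentiable[OF p]]
    unfolding gram_def hat_products lorentz_pd_Xhat[OF p] xu d by (simp add: power2_eq_square)
  have "connection_form A X n e4 x G = (1 / r) * lorentz (a *\<^sub>R n1 + b *\<^sub>R n2) (T0 + G)"
  proof -
    have "surf_deriv A X n (p u) (a *\<^sub>R d1 + b *\<^sub>R d2) = a *\<^sub>R n1 + b *\<^sub>R n2"
      using surf_deriv_coords[OF p n_differentiable[OF p]] by (simp add: d)
    then have "surf_deriv A X n x G = a *\<^sub>R n1 + b *\<^sub>R n2" unfolding grad(1) xu .
    then show ?thesis
      by (simp add: connection_form_def e4_eq[OF x, folded Gr] lorentz_scaleR)
  qed
  \<comment> \<open>The \<open>T0\<close> summand drops out, and expanding \<open>G\<close> leaves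
    the second fundamental form evaluated on the gradient.\<close>
  also have "lorentz (a *\<^sub>R n1 + b *\<^sub>R n2) (T0 + G) = a\<^sup>2 * lorentz n1 d1 + a * b * ?h + b\<^sup>2 * lorentz n2 d2"
    unfolding grad(1) by (simp add: lorentz_simps nT algebra_simps power2_eq_square)
  finally have alpha: "connection_form A X n e4 x G =
    (a\<^sup>2 * lorentz n1 d1 + a * b * ?h + b\<^sup>2 * lorentz n2 d2) / r" by simp
  have "mean_curvature_wrt A Xhat n x * r =
    (?M / gram d1 d2) * r
      - (a\<^sup>2 * lorentz n1 d1 + a * b * ?h + b\<^sup>2 * lorentz n2 d2) / r"
    unfolding k gram_def
    by (rule projected_curvature_identity(2)[OF pos[unfolded gram_def] grad(5) ab[unfolded gram_def] grad(4)])
  then have "r * mean_curvature_wrt A Xhat n x = - (- ?M / gram d1 d2) * r - connection_form A X n e4 x G"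
    unfolding alpha minus_divide_left[symmetric] minus_minus by (simp only: mult.commute)
  then show ?thesis
    unfolding H Gr .
qed

text \<open>In a chart \<open>stretch\<close> is the quotient of the area densities of
  \<open>Xhat\<close> and \<open>X\<close>, both continuous, the denominator being positive.
  Preimages of open sets are thus unions of chart images of open sets, hence open.\<close>

lemma stretch_measurable: "stretch \<in> borel_measurable (borel_space S)"
proof -
  have cont: "continuous_on U (\<lambda>u. stretch (p u))" if p: "(U, p) \<in> A" for U p
  proof -
    have "continuous_on U (\<lambda>u. area_density Xhat p u / area_density X p u)"
      using area_density_projected(2)[OF p]
      by (intro continuous_on_divide continuous_on_area_density smooth_along_chart[OF surface _ p]
          smooth smooth_Xhat) fastforce
    then show ?thesis
      by (rule continuous_on_eq) (use area_density_projected(1,2)[OF p] in fastforce)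
  qed
  show ?thesis
  proof (rule borel_measurableI)
    fix V :: "real set" assume V: "open V"
    have "stretch -` V \<inter> space (borel_space S) = (\<Union>(U, p)\<in>A. p ` {u \<in> U. stretch (p u) \<in> V})"
    proof
      show "stretch -` V \<inter> space (borel_space S) \<subseteq> (\<Union>(U, p)\<in>A. p ` {u \<in> U. stretch (p u) \<in> V})"
      proof
        fix x assume x: "x \<in> stretch -` V \<inter> space (borel_space S)"
        then have "x \<in> topspace S" by (simp add: space_borel_space)
        then obtain U p u where "(U, p) \<in> A" "u \<in> U" "p u = x"
          using surface_covered[OF surface] by metis
        then show "x \<in> (\<Union>(U, p)\<in>A. p ` {u \<in> U. stretch (p u) \<in> V})" using x by blast
      qed
      show "(\<Union>(U, p)\<in>A. p ` {u \<in> U. stretch (p u) \<in> V}) \<subseteq> stretch -` V \<inter> space (borel_space S)"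
        using surface_chart(4)[OF surface] by (auto simp: space_borel_space)
    qed
    also have "openin S \<dots>"
    proof (rule openin_Union, clarsimp)
      fix U p assume p: "(U, p) \<in> A"
      have "open {u \<in> U. stretch (p u) \<in> V}"
        using continuous_on_open_vimage[OF surface_chart(1)[OF surface p], of "\<lambda>u. stretch (p u)"] cont[OF p] V
        by (auto simp: vimage_def Int_def conj_commute)
      then show "openin S (p ` {u \<in> U. stretch (p u) \<in> V})"
        by (rule surface_chart(6)[OF surface p]) auto
    qed
    finally show "stretch -` V \<inter> space (borel_space S) \<in> sets (borel_space S)"
      unfolding sets_borel_space by (simp add: sigma_sets.Basic)
  qed
qed

lemma area_measure_projected:
  assumes "topspace S \<noteq> {}"
  shows "area_measure S A Xhat = density (area_measure S A X) stretch"
  by (rule area_measure_density[OF surface assms smooth smooth_Xhat stretch_measurable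
        area_density_projected(1)]) (assumption | rule less_imp_le[OF stretch_pos])+

end

text \<open>The charts of the image are \<open>Y \<circ> p\<close> with immersion \<open>id\<close>,
  and injectivity of \<open>Y\<close> matches the charts at \<open>Y x\<close> with those at
  \<open>x\<close>. The conditions inside the descriptions of tangent space and derivative are then
  the same on both sides.\<close>

lemma mean_curvature_wrt_image:
  assumes S: "smooth_surface S A" and inj: "inj_on Y (topspace S)" and x: "x \<in> topspace S"
  shows "mean_curvature_wrt (image_atlas Y A) id \<nu> (Y x) = mean_curvature_wrt A Y (\<lambda>x. \<nu> (Y x)) x"
proof -
  have eq: "Y (p u) = Y x \<longleftrightarrow> p u = x" if "(U, p) \<in> A" "u \<in> U" for U p u
    using inj x surface_chart(4)[OF S that] by (auto simp: inj_on_def)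
  have tangent: "tangent_space (image_atlas Y A) id (Y x) = tangent_space A Y x"
    unfolding tangent_space_def image_atlas_def using eq by fastforce
  have "(\<exists>U p u \<xi>. (U, p) \<in> image_atlas Y A \<and> u \<in> U \<and> p u = Y x \<and>
      frechet_derivative (id \<circ> p) (at u) \<xi> = Z \<and> w = frechet_derivative (\<nu> \<circ> p) (at u) \<xi>) \<longleftrightarrow>
    (\<exists>U p u \<xi>. (U, p) \<in> A \<and> u \<in> U \<and> p u = x \<and>
      frechet_derivative (Y \<circ> p) (at u) \<xi> = Z \<and> w = frechet_derivative ((\<lambda>x. \<nu> (Y x)) \<circ> p) (at u) \<xi>)"
    (is "?L \<longleftrightarrow> ?R") for Z w
  proof
    assume ?L
    then obtain U p u \<xi> where *: "(U, p) \<in> A" "u \<in> U" "Y (p u) = Y x"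
      "frechet_derivative (Y \<circ> p) (at u) \<xi> = Z" "w = frechet_derivative (\<nu> \<circ> (Y \<circ> p)) (at u) \<xi>"
      unfolding image_atlas_def by auto
    then show ?R using eq[OF *(1,2)] by (auto simp: o_def)
  next
    assume ?R
    then obtain U p u \<xi> where *: "(U, p) \<in> A" "u \<in> U" "p u = x"
      "frechet_derivative (Y \<circ> p) (at u) \<xi> = Z" "w = frechet_derivative (\<nu> \<circ> (Y \<circ> p)) (at u) \<xi>"
      by (auto simp: o_def)
    moreover have "(U, Y \<circ> p) \<in> image_atlas Y A" using *(1) by (force simp: image_atlas_def)
    moreover have "id \<circ> (Y \<circ> p) = Y \<circ> p" "(Y \<circ> p) u = Y x" using *(3) by auto
    ultimately show ?L by metis
  qed
  then have "surf_deriv (image_atlas Y A) id \<nu> (Y x) = surf_deriv A Y (\<lambda>x. \<nu> (Y x)) x"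
    unfolding surf_deriv_def by presburger
  then show ?thesis unfolding mean_curvature_wrt_def tangent by simp
qed

lemma diffeomorphic_S2_nonempty:
  assumes "diffeomorphic_S2 S A"
  shows "topspace S \<noteq> {}"
proof -
  obtain f g where "homeomorphic_maps S (top_of_set (sphere (0::real^3) 1)) f g"
    using assms unfolding diffeomorphic_S2_def diffeomorphic_surfaces_def by blast
  then have "g ` sphere 0 1 \<subseteq> topspace S"
    unfolding homeomorphic_maps_def using continuous_map_image_subset_topspace by fastforce
  moreover have "sphere (0::real^3) 1 \<noteq> {}" by simp
  ultimately show ?thesis by blast
qed

text \<open>Injectivity of the derivative turns nonzero coordinates into a nonzero tangent vector,
  on which the metric is positive; \<open>spacelike_plane\<close> extracts the two
  inequalities.\<close>

lemma spacelike_surfaceI: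
  assumes S: "smooth_surface S A" and X: "smooth_embedding S A X" and sp: "spacelike S A X"
  shows "spacelike_surface S A X"
proof
  show smooth: "smooth_along A (topspace S) X" using X unfolding smooth_embedding_def by simp
  fix U p u assume p: "(U, p) \<in> A" "u \<in> U"
  have "(X \<circ> p) differentiable (at u)"
    using smooth_on_differentiable[OF smooth_along_chart[OF S smooth p(1)] p(2)] .
  then have lin: "linear (frechet_derivative (X \<circ> p) (at u))" by (rule linear_frechet_derivative)
  have inj: "inj (frechet_derivative (X \<circ> p) (at u))"
    using X p unfolding smooth_embedding_def by blast
  have "0 < lorentz (a *\<^sub>R pd X p 1 u + b *\<^sub>R pd X p 2 u) (a *\<^sub>R pd X p 1 u + b *\<^sub>R pd X p 2 u)"
    if "a \<noteq> 0 \<or> b \<noteq> 0" for a b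
  proof -
    let ?\<xi> = "vector [a, b] :: real^2"
    have eq: "frechet_derivative (X \<circ> p) (at u) ?\<xi> = a *\<^sub>R pd X p 1 u + b *\<^sub>R pd X p 2 u"
      using linear_on_plane[OF lin, of ?\<xi>] by simp
    have "?\<xi> \<noteq> 0" using that by (auto simp: vec_eq_iff forall_2)
    then have "frechet_derivative (X \<circ> p) (at u) ?\<xi> \<noteq> 0"
      using inj lin linear_injective_0 by blast
    moreover have "frechet_derivative (X \<circ> p) (at u) ?\<xi> \<in> tangent_space A X (p u)"
      unfolding tangent_space_def using p by blast
    ultimately show ?thesis
      using sp surface_chart(4)[OF S p] unfolding spacelike_def eq by blast
  qed
  from spacelike_plane[OF this]
  show "0 < lorentz (pd X p 1 u) (pd X p 1 u) \<and> 0 < gram (pd X p 1 u) (pd X p 2 u)" by blast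
qed (rule S)

theorem proposition3p1:
  fixes S :: "'a topology" and A :: "'a atlas" and X Xhat e3 e4 :: "'a \<Rightarrow> minkowski"
    and T0 :: minkowski and \<tau> :: "'a \<Rightarrow> real"
    and Sigma_hat :: "minkowski set" and A_hat :: "minkowski atlas"
    and \<nu> :: "minkowski \<Rightarrow> minkowski"
  assumes "smooth_surface S A" and "diffeomorphic_S2 S A"
    and "smooth_embedding S A X" and "spacelike S A X"
    and "future_unit_timelike T0"
    and "\<tau> = (\<lambda>x. - lorentz (X x) T0)"
    and "Xhat = (\<lambda>x. X x - \<tau> x *\<^sub>R T0)"
    and "smooth_embedding S A Xhat"
    and "Sigma_hat = Xhat ` topspace S" and "A_hat = image_atlas Xhat A"
    and "outward_unit_normal (orth_complement T0) Sigma_hat A_hat \<nu>"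
    and "e3 = (\<lambda>x. \<nu> (Xhat x))"
    and "unit_normal_e4 S A X e3 e4"
  shows "(\<integral>y. mean_curvature_wrt A_hat id \<nu> y \<partial>area_measure (top_of_set Sigma_hat) A_hat id) =
    (\<integral>x. (let G = surf_gradient A X \<tau> x in
        - lorentz (mean_curvature_vector S A X x) (e3 x) * sqrt (1 + lorentz G G)
        - connection_form A X e3 e4 x G) \<partial>area_measure S A X)"
proof -
  note S = assms(1)
  have ne: "topspace S \<noteq> {}" by (rule diffeomorphic_S2_nonempty[OF assms(2)])
  have smooth_Xhat: "smooth_along A (topspace S) Xhat" and emb: "embedding_map S euclidean Xhat"
    using assms(8) unfolding smooth_embedding_def by auto
  have \<nu>: "smooth_along A_hat Sigma_hat \<nu>" "\<And>y. y \<in> Sigma_hat \<Longrightarrow> \<nu> y \<in> orth_complement T0"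
    "\<And>y. y \<in> Sigma_hat \<Longrightarrow> lorentz (\<nu> y) (\<nu> y) = 1"
    "\<And>y Y. y \<in> Sigma_hat \<Longrightarrow> Y \<in> tangent_space A_hat id y \<Longrightarrow> lorentz (\<nu> y) Y = 0"
    using assms(11) unfolding outward_unit_normal_def by auto
  have A_hat: "(U, Xhat \<circ> p) \<in> A_hat" if "(U, p) \<in> A" for U p
    using that unfolding assms(10) image_atlas_def by force
  have in_hat: "Xhat x \<in> Sigma_hat" if "x \<in> topspace S" for x
    using that unfolding assms(9) by simp
  interpret spacelike_surface S A X by (rule spacelike_surfaceI[OF assms(1,3,4)])
  interpret projected_surface S A X T0 \<tau> Xhat e3 e4
  proof
    fix U p u assume p: "(U, p) \<in> A" "u \<in> U"
    have "{u \<in> U. (Xhat \<circ> p) u \<in> Sigma_hat} = U"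
      using in_hat surface_chart(4)[OF S p(1)] by auto
    then have "smooth_on U (\<nu> \<circ> (Xhat \<circ> p))"
      using \<nu>(1) A_hat[OF p(1)] unfolding smooth_along_def by force
    moreover have "\<nu> \<circ> (Xhat \<circ> p) = e3 \<circ> p" by (simp add: assms(12) o_def)
    ultimately show "(e3 \<circ> p) differentiable (at u)"
      using smooth_on_differentiable p(2) by metis
    \<comment> \<open>The image surface is immersed by \<open>id\<close>, so its coordinate vectors
      in the image atlas are those of \<open>Xhat\<close>, and orthogonality of \<open>\<nu>\<close>
      applies to them.\<close>
    have "frechet_derivative (id \<circ> (Xhat \<circ> p)) (at u) (axis i 1) \<in> tangent_space A_hat id (Xhat (p u))" for i
      unfolding tangent_space_def using A_hat[OF p(1)] p(2) by force
    then show "lorentz (e3 (p u)) (pd Xhat p i u) = 0" for i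
      using \<nu>(4)[OF in_hat[OF surface_chart(4)[OF S p]]] by (simp add: assms(12))
  next
    fix x assume "x \<in> topspace S"
    from \<nu>(2,3)[OF in_hat[OF this]]
    show "lorentz (e3 x) (e3 x) = 1" "lorentz (e3 x) T0 = 0"
      by (simp_all add: assms(12) orth_complement_def)
  qed (fact assms smooth_Xhat)+
  let ?T = "top_of_set Sigma_hat" and ?\<mu> = "area_measure S A X" and ?\<mu>' = "area_measure S A Xhat"
  have \<mu>: "sets ?\<mu> = borel_sets S" "space ?\<mu> = topspace S"
    using is_area_measure_area_measure[OF S ne smooth] unfolding is_area_measure_def by auto
  have \<mu>': "sets ?\<mu>' = borel_sets S" "space ?\<mu>' = topspace S"
    using is_area_measure_area_measure[OF S ne smooth_Xhat] unfolding is_area_measure_def by auto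
  have "homeomorphic_map S ?T Xhat"
    using emb unfolding embedding_map_def assms(9) by simp
  then obtain g where g: "homeomorphic_maps S ?T Xhat g"
    using homeomorphic_map_maps by blast
  then have cont: "continuous_map S ?T Xhat" "continuous_map ?T S g"
    unfolding homeomorphic_maps_def by auto
  have stretch: "stretch \<in> borel_measurable ?\<mu>"
    using stretch_measurable measurable_cong_sets[of ?\<mu> "borel_space S" borel borel] \<mu>(1) sets_borel_space
    by metis
  have inj: "inj_on Xhat (topspace S)"
    using g unfolding homeomorphic_maps_def by (metis inj_on_inverseI)
  \<comment> \<open>Two changes of measure lead from the left to the right: the pushforward along
    \<open>Xhat\<close> brings the integral to \<open>S\<close>, and the density
    \<open>stretch\<close> replaces the area of \<open>Xhat\<close> by that of
    \<open>X\<close>.\<close>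
  have "(\<integral>y. mean_curvature_wrt A_hat id \<nu> y \<partial>area_measure ?T A_hat id) =
      (\<integral>y. mean_curvature_wrt A_hat id \<nu> y \<partial>distr ?\<mu>' (borel_space ?T) Xhat)"
    using area_measure_image[OF S ne smooth_Xhat emb] unfolding assms(9,10) by simp
  also have "\<dots> = (\<integral>x. mean_curvature_wrt A_hat id \<nu> (Xhat x) \<partial>?\<mu>')"
  proof (rule integral_distr_bij)
    show "Xhat \<in> measurable ?\<mu>' (borel_space ?T)"
      by (rule measurable_continuous_map[OF cont(1) \<mu>' sets_borel_space])
    show "g \<in> measurable (borel_space ?T) ?\<mu>'"
      by (rule measurable_continuous_map[OF cont(2) sets_borel_space space_borel_space \<mu>'(1)])
    show "Xhat (g y) = y" if "y \<in> space (borel_space ?T)" for y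
      using g that unfolding homeomorphic_maps_def space_borel_space by blast
  qed
  also have "\<dots> = (\<integral>x. mean_curvature_wrt A Xhat e3 x \<partial>?\<mu>')"
    using mean_curvature_wrt_image[OF S inj]
    by (intro Bochner_Integration.integral_cong refl) (simp add: \<mu>' assms(10,12))
  also have "\<dots> = (\<integral>x. stretch x * mean_curvature_wrt A Xhat e3 x \<partial>?\<mu>)"
    unfolding area_measure_projected[OF ne]
    by (rule integral_density_pos[OF stretch]) (simp only: \<mu>(2) stretch_pos)
  also have "\<dots> = (\<integral>x. (let G = surf_gradient A X \<tau> x in
        - lorentz (mean_curvature_vector S A X x) (e3 x) * sqrt (1 + lorentz G G)
        - connection_form A X e3 e4 x G) \<partial>?\<mu>)"
    unfolding Let_def
    by (intro Bochner_Integration.integral_cong refl mean_curvature_projected) (simp only: \<mu>(2))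
  finally show ?thesis .
qed

end
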